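(* Let $\mathbf{L}$ be a modal many-valued logic and let $\mathcal{M}_{\mathbf{L}}=\langle W_{\mathbf{L}},R_{\mathbf{L}},\mathrm{Val}_{\mathbf{L}}\rangle$ be its canonical model. Then, with $\mathrm{Val}_{\mathbf{L}}$ extended inductively from propositional variables to all formulas as in any many-valued Kripke model, $$\mathrm{Val}_{\mathbf{L}}(\phi,u)=u(\phi)$$ for every formula $\phi\in\mathsf{Form}$ and every $u\in W_{\mathbf{L}}$.
   Context: Formulas: let $\mathsf{Prop}$ be an infinite set of propositional variables. $\mathsf{Form}$ is the smallest set containing $\mathsf{Prop}$ and containing $\neg\phi$, $\phi\oplus\psi$, $\square\phi$ whenever it contains $\phi,\psi$. Abbreviations: $\phi\to\psi$ is $\psi\oplus\neg\phi$; $\psi\odot\phi$ is $\neg(\neg\psi\oplus\neg\phi)$; $\phi\leftrightarrow\psi$ is $(\phi\to\psi)\odot(\psi\to\phi)$; $\phi^m$ is $\phi\odot\cdots\odot\phi$ ($m$ factors). A many-valued Kripke model $\langle W,R,\mathrm{Val}\rangle$ consists of a set $W$ of worlds (non-empty), a relation $R\subseteq W\times W$ and a map $\mathrm{Val}:\mathsf{Prop}\times W\to[0,1]$, extended to formulas by $\mathrm{Val}(\phi\oplus\psi,w)=\min(\mathrm{Val}(\phi,w)+\mathrm{Val}(\psi,w),1)$, $\mathrm{Val}(\neg\phi,w)=1-\mathrm{Val}(\phi,w)$, $\mathrm{Val}(\square\phi,w)=\inf\{\mathrm{Val}(\phi,w')\mid(w,w')\in R\}$ (infimum in $[0,1]$,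 so the infimum of the empty set is $1$). A modal many-valued logic is a set $\mathbf{L}\subseteq\mathsf{Form}$ closed under modus ponens, uniform substitution, and the necessitation rule (from $\phi$ infer $\square\phi$), and containing: (i) $p\to(q\to p)$, $(p\to q)\to((q\to r)\to(p\to r))$, $((p\to q)\to q)\to((q\to p)\to p)$, $(\neg p\to\neg q)\to(q\to p)$ (an axiomatic base of infinite-valued Łukasiewicz logic); (ii) $\square(p\to q)\to(\square p\to\square q)$; (iii) $\square(p\oplus p)\leftrightarrow\square p\oplus\square p$ and $\square(p\odot p)\leftrightarrow\square p\odot\square p$; (iv) $\square(p\oplus p^m)\leftrightarrow(\square p\oplus(\square p)^m)$ for every positive integer $m$. $\mathcal{F}_{\mathbf{L}}$ is the free $\mathbf{L}$-algebra over $\mathsf{Prop}$, i.e. the set of formulas modulo $\mathbf{L}$-equivalence ($\phi$ and $\psi$ are equivalent iff $\phi\leftrightarrow\psi\in\mathbf{L}$), with the induced operations $\oplus,\odot,\neg,\square,0,1$ (where $1$ is the class of the theorems of $\mathbf{L}$ and $0=\neg 1$). A formula is identified with its class in $\mathcal{F}_{\mathbf{L}}$. The interval $[0,1]$ is the MV-algebra with $x\oplus y=\min(x+y,1)$, $\neg x=1-x$, $x\odot y=\max(x+y-1,0)$. The canonical model $\mathcal{M}_{\mathbf{L}}=\langle W_{\mathbf{L}},R_{\mathbf{L}},\mathrm{Val}_{\mathbf{L}}\rangle$: $W_{\mathbf{L}}$ is the set of MV-algebra homomorphisms $\mathcal{F}_{\mathbf{L}}\to[0,1]$ (preserving $\oplus,\odot,\neg,0,1$,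 not necessarily $\square$); $(u,v)\in R_{\mathbf{L}}$ iff for every $\phi\in\mathcal{F}_{\mathbf{L}}$, $u(\square\phi)=1$ implies $v(\phi)=1$; and $\mathrm{Val}_{\mathbf{L}}(p,u)=u(p)$ for $p\in\mathsf{Prop}$ and $u\in W_{\mathbf{L}}$.
   Formalization: A modal many-valued logic is also required to contain (p⊕q)↔(¬q→p); the listed axioms alone do not make L-equivalence compatible with ⊕, and this clause holds exactly when the induced operation ⊕ on the free algebra is well defined. *)

theory Defs
  imports Complex_Main "HOL-Library.FuncSet"
begin

text \<open>
  The propositional variables are the elements of the type \<open>'p\<close>; that there are infinitely many of
  them is a hypothesis of the theorem.
\<close>

datatype 'p mform =
    PVar 'p
  | FNeg "'p mform"                   ("\<^bold>\<not> _" [90] 90)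
  | FPlus "'p mform" "'p mform"       (infixl "\<^bold>\<oplus>" 75)
  | FBox "'p mform"                   ("\<^bold>\<box> _" [90] 90)

definition fimp :: "'p mform \<Rightarrow> 'p mform \<Rightarrow> 'p mform"  (infixr "\<^bold>\<rightarrow>" 65)
  where "\<phi> \<^bold>\<rightarrow> \<psi> = \<psi> \<^bold>\<oplus> \<^bold>\<not> \<phi>"

definition ftimes :: "'p mform \<Rightarrow> 'p mform \<Rightarrow> 'p mform"  (infixl "\<^bold>\<odot>" 80)
  where "\<psi> \<^bold>\<odot> \<phi> = \<^bold>\<not> (\<^bold>\<not> \<psi> \<^bold>\<oplus> \<^bold>\<not> \<phi>)"

definition fiff :: "'p mform \<Rightarrow> 'p mform \<Rightarrow> 'p mform"  (infix "\<^bold>\<leftrightarrow>" 60)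
  where "(\<phi> \<^bold>\<leftrightarrow> \<psi>) = (\<phi> \<^bold>\<rightarrow> \<psi>) \<^bold>\<odot> (\<psi> \<^bold>\<rightarrow> \<phi>)"

text \<open>
  \<open>fpow \<phi> m\<close> is the product of \<open>m\<close> factors \<open>\<phi>\<close>, bracketed to the right; it is meant for \<open>m \<ge> 1\<close> only.
\<close>

definition fpow :: "'p mform \<Rightarrow> nat \<Rightarrow> 'p mform"
  where "fpow \<phi> m = ((\<lambda>\<psi>. \<phi> \<^bold>\<odot> \<psi>) ^^ (m - 1)) \<phi>"

primrec fsubst :: "('p \<Rightarrow> 'p mform) \<Rightarrow> 'p mform \<Rightarrow> 'p mform" where
  "fsubst \<sigma> (PVar p) = \<sigma> p"
| "fsubst \<sigma> (\<^bold>\<not> \<phi>) = \<^bold>\<not> (fsubst \<sigma> \<phi>)"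
| "fsubst \<sigma> (\<phi> \<^bold>\<oplus> \<psi>) = fsubst \<sigma> \<phi> \<^bold>\<oplus> fsubst \<sigma> \<psi>"
| "fsubst \<sigma> (\<^bold>\<box> \<phi>) = \<^bold>\<box> (fsubst \<sigma> \<phi>)"


section \<open>Many-valued Kripke models\<close>

record ('p, 'w) mv_model =
  worlds :: "'w set"
  accs :: "('w \<times> 'w) set"
  val :: "'p \<Rightarrow> 'w \<Rightarrow> real"

definition mv_kripke_model :: "('p, 'w) mv_model \<Rightarrow> bool" where
  "mv_kripke_model M \<longleftrightarrow>
     worlds M \<noteq> {} \<and> accs M \<subseteq> worlds M \<times> worlds M \<and>
     (\<forall>p. \<forall>w \<in> worlds M. val M p w \<in> {0..1})"

text \<open>
  The infimum of the empty set is taken in \<open>[0,1]\<close>, hence is 1; \<^term>\<open>Inf {} :: real\<close> would not be.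
\<close>

definition inf01 :: "real set \<Rightarrow> real"
  where "inf01 S = (if S = {} then 1 else Inf S)"

primrec fval :: "('p, 'w) mv_model \<Rightarrow> 'p mform \<Rightarrow> 'w \<Rightarrow> real" where
  "fval M (PVar p) w = val M p w"
| "fval M (\<^bold>\<not> \<phi>) w = 1 - fval M \<phi> w"
| "fval M (\<phi> \<^bold>\<oplus> \<psi>) w = min (fval M \<phi> w + fval M \<psi> w) 1"
| "fval M (\<^bold>\<box> \<phi>) w = inf01 {fval M \<phi> w' | w'. (w, w') \<in> accs M}"


section \<open>Modal many-valued logics\<close>

text \<open>
  Since \<open>p \<rightarrow> q\<close> abbreviates \<open>q \<oplus> \<not> p\<close>, the four implication axioms say nothing about a sum whose
  right summand is not a negation: on their own they are a base of infinite-valued Lukasiewicz logic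
  only in the language of \<open>\<rightarrow>\<close> and \<open>\<not>\<close>. The clause \<open>p \<oplus> q \<leftrightarrow> (\<not> q \<rightarrow> p)\<close> (that is,
  \<open>p \<oplus> q \<leftrightarrow> p \<oplus> \<not>\<not> q\<close>), itself a theorem of Lukasiewicz logic, makes them a base in the language
  of \<open>\<oplus>\<close> and \<open>\<not>\<close>. Given the other clauses it holds exactly when equivalence modulo \<open>L\<close> is compatible
  with \<open>\<oplus>\<close>, so it is what the quotient algebra below presupposes.

  As \<open>L\<close> is closed under substitution, stating the axioms for all variables \<open>p\<close>, \<open>q\<close>, \<open>r\<close> is the
  same as stating them for three fixed distinct ones.
\<close>

definition modal_mv_logic :: "'p mform set \<Rightarrow> bool" where
  "modal_mv_logic L \<longleftrightarrow>
     (\<forall>\<phi> \<psi>. \<phi> \<in> L \<longrightarrow> \<phi> \<^bold>\<rightarrow> \<psi> \<in> L \<longrightarrow> \<psi> \<in> L) \<and>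
     (\<forall>\<phi> \<sigma>. \<phi> \<in> L \<longrightarrow> fsubst \<sigma> \<phi> \<in> L) \<and>
     (\<forall>\<phi>. \<phi> \<in> L \<longrightarrow> \<^bold>\<box> \<phi> \<in> L) \<and>
     (\<forall>p q r. let p = PVar p; q = PVar q; r = PVar r in
        p \<^bold>\<rightarrow> (q \<^bold>\<rightarrow> p) \<in> L \<and>
        (p \<^bold>\<rightarrow> q) \<^bold>\<rightarrow> ((q \<^bold>\<rightarrow> r) \<^bold>\<rightarrow> (p \<^bold>\<rightarrow> r)) \<in> L \<and>
        ((p \<^bold>\<rightarrow> q) \<^bold>\<rightarrow> q) \<^bold>\<rightarrow> ((q \<^bold>\<rightarrow> p) \<^bold>\<rightarrow> p) \<in> L \<and>
        (\<^bold>\<not> p \<^bold>\<rightarrow> \<^bold>\<not> q) \<^bold>\<rightarrow> (q \<^bold>\<rightarrow> p) \<in> L \<and>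
        ((p \<^bold>\<oplus> q) \<^bold>\<leftrightarrow> (\<^bold>\<not> q \<^bold>\<rightarrow> p)) \<in> L \<and>
        \<^bold>\<box> (p \<^bold>\<rightarrow> q) \<^bold>\<rightarrow> (\<^bold>\<box> p \<^bold>\<rightarrow> \<^bold>\<box> q) \<in> L \<and>
        (\<^bold>\<box> (p \<^bold>\<oplus> p) \<^bold>\<leftrightarrow> (\<^bold>\<box> p \<^bold>\<oplus> \<^bold>\<box> p)) \<in> L \<and>
        (\<^bold>\<box> (p \<^bold>\<odot> p) \<^bold>\<leftrightarrow> (\<^bold>\<box> p \<^bold>\<odot> \<^bold>\<box> p)) \<in> L \<and>
        (\<forall>m \<ge> 1. (\<^bold>\<box> (p \<^bold>\<oplus> fpow p m) \<^bold>\<leftrightarrow> (\<^bold>\<box> p \<^bold>\<oplus> fpow (\<^bold>\<box> p) m)) \<in> L))"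


section \<open>The free algebra\<close>

definition logeq :: "'p mform set \<Rightarrow> ('p mform \<times> 'p mform) set"
  where "logeq L = {(\<phi>, \<psi>). (\<phi> \<^bold>\<leftrightarrow> \<psi>) \<in> L}"

definition fcls :: "'p mform set \<Rightarrow> 'p mform \<Rightarrow> 'p mform set"
  where "fcls L \<phi> = logeq L `` {\<phi>}"

definition free_alg :: "'p mform set \<Rightarrow> 'p mform set set"
  where "free_alg L = UNIV // logeq L"

definition alg_neg :: "'p mform set \<Rightarrow> 'p mform set \<Rightarrow> 'p mform set"
  where "alg_neg L X = (\<Union>\<phi>\<in>X. fcls L (\<^bold>\<not> \<phi>))"

definition alg_plus :: "'p mform set \<Rightarrow> 'p mform set \<Rightarrow> 'p mform set \<Rightarrow> 'p mform set"
  where "alg_plus L X Y = (\<Union>\<phi>\<in>X. \<Union>\<psi>\<in>Y. fcls L (\<phi> \<^bold>\<oplus> \<psi>))"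

definition alg_times :: "'p mform set \<Rightarrow> 'p mform set \<Rightarrow> 'p mform set \<Rightarrow> 'p mform set"
  where "alg_times L X Y = (\<Union>\<phi>\<in>X. \<Union>\<psi>\<in>Y. fcls L (\<phi> \<^bold>\<odot> \<psi>))"

definition alg_box :: "'p mform set \<Rightarrow> 'p mform set \<Rightarrow> 'p mform set"
  where "alg_box L X = (\<Union>\<phi>\<in>X. fcls L (\<^bold>\<box> \<phi>))"

text \<open>The theorems of \<open>L\<close> form a single class, which is the unit; as a set of formulas it is \<open>L\<close>.\<close>

definition alg_one :: "'p mform set \<Rightarrow> 'p mform set"
  where "alg_one L = L"

definition alg_zero :: "'p mform set \<Rightarrow> 'p mform set"
  where "alg_zero L = alg_neg L (alg_one L)"


section \<open>The canonical model\<close>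

text \<open>
  A homomorphism is a function on the carrier \<^term>\<open>free_alg L\<close>, represented as an extensional
  function, so that distinct worlds are distinct homomorphisms.
\<close>

definition mv_homs :: "'p mform set \<Rightarrow> ('p mform set \<Rightarrow> real) set" where
  "mv_homs L = {u \<in> free_alg L \<rightarrow>\<^sub>E {0..1}.
     (\<forall>X \<in> free_alg L. \<forall>Y \<in> free_alg L. u (alg_plus L X Y) = min (u X + u Y) 1) \<and>
     (\<forall>X \<in> free_alg L. \<forall>Y \<in> free_alg L. u (alg_times L X Y) = max (u X + u Y - 1) 0) \<and>
     (\<forall>X \<in> free_alg L. u (alg_neg L X) = 1 - u X) \<and>
     u (alg_zero L) = 0 \<and> u (alg_one L) = 1}"

definition canonical_model ::
  "'p mform set \<Rightarrow> ('p, 'p mform set \<Rightarrow> real) mv_model" where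
  "canonical_model L =
     \<lparr> worlds = mv_homs L,
       accs = {(u, v). u \<in> mv_homs L \<and> v \<in> mv_homs L \<and>
                 (\<forall>X \<in> free_alg L. u (alg_box L X) = 1 \<longrightarrow> v X = 1)},
       val = (\<lambda>p u. u (fcls L (PVar p))) \<rparr>"

lemma fcls_in_free_alg: "fcls L \<phi> \<in> free_alg L"
  unfolding fcls_def free_alg_def by (rule quotientI) simp

text \<open>For inconsistent \<open>L\<close> there are no homomorphisms, hence the side condition.\<close>

lemma mv_kripke_model_canonical_model:
  assumes "mv_homs L \<noteq> {}"
  shows "mv_kripke_model (canonical_model L)"
  using assms fcls_in_free_alg[of L]
  unfolding mv_kripke_model_def canonical_model_def mv_homs_def by (auto simp: PiE_iff)

end

theory Submission
  imports Defs
begin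

text \<open>
  The only inductive step that needs an argument is \<open>\<box>\<close>: for a world \<open>u\<close>, the number \<open>u (\<box>\<phi>)\<close> has to
  be the infimum of \<open>v \<phi>\<close> over the successors \<open>v\<close> of \<open>u\<close>.

  The maps \<open>x \<mapsto> x \<oplus> x\<close> and \<open>x \<mapsto> x \<odot> x\<close> commute with \<open>\<box>\<close> modulo the logic, and whenever
  \<open>0 \<le> x < y \<le> 1\<close> some composition \<open>\<tau>\<close> of them satisfies \<open>\<tau> x < 1 = \<tau> y\<close> (lemma \<open>separate\<close>). So
  statements comparing \<open>u (\<box>\<phi>)\<close> with a number turn into statements about whether \<open>u (\<box>\<tau>\<phi>)\<close> is 1,
  which is what the canonical relation speaks of. If \<open>v \<phi> < u (\<box>\<phi>)\<close> for a successor \<open>v\<close>, then a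
  separating \<open>\<tau>\<close> gives \<open>u (\<box>\<tau>\<phi>) = 1\<close> and \<open>v (\<tau>\<phi>) < 1\<close>, a contradiction (\<open>box_le_successor\<close>).
  For the converse inequality it suffices, again by a separating \<open>\<tau>\<close>, to find for every \<open>\<psi>\<close> with
  \<open>u (\<box>\<psi>) < 1\<close> a successor \<open>v\<close> with \<open>v \<psi> < 1\<close> (\<open>ex_successor_lt_one\<close>).

  The set \<open>F = {\<phi>. u (\<box>\<phi>) = 1}\<close> contains the logic and is closed under modus ponens, and \<open>\<psi>\<close> is not
  in it. In general, this alone would not yield a real-valued \<open>v\<close> with \<open>v = 1\<close> on \<open>F\<close> and \<open>v \<psi> < 1\<close>,
  since \<open>\<psi>\<close> could be infinitesimally close to 1 modulo \<open>F\<close>. The axioms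
  \<open>\<box>(p \<oplus> p\<^sup>m) \<leftrightarrow> \<box>p \<oplus> (\<box>p)\<^sup>m\<close> exclude this: as \<open>u (\<box>\<psi>) < 1\<close>, for large \<open>m\<close> the power
  \<open>(\<box>\<psi>)\<^sup>m\<close> has value 0 at \<open>u\<close>, and so \<open>\<psi> \<oplus> \<psi>\<^sup>m\<close> is not in \<open>F\<close>. By Zorn's lemma \<open>F\<close> extends to
  a theory \<open>P\<close> without \<open>\<psi> \<oplus> \<psi>\<^sup>m\<close> whose Lindenbaum algebra is a chain (\<open>ex_lin_theory_avoiding\<close>).
  Every nontrivial MV-chain has a homomorphism to \<open>[0,1]\<close>: by a construction of Chang it is the
  unit interval of a lexicographically ordered abelian group, in which an element is measured
  against the unit by repeated doubling. In the chain of \<open>P\<close> the sum of \<open>\<psi>\<close> and \<open>\<psi>\<^sup>m\<close> is not 1, and so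
  the resulting \<open>v\<close> satisfies \<open>v \<psi> + v (\<psi>\<^sup>m) \<le> 1\<close>; this is impossible if \<open>v \<psi> = 1\<close>.
\<close>

section \<open>MV-algebras\<close>

text \<open>
  MV-algebras with an explicit carrier, as they are to be instantiated with quotients of the set of
  formulas by relations that vary within a proof.
\<close>

locale mv_algebra =
  fixes C :: "'a set"
    and plus :: "'a \<Rightarrow> 'a \<Rightarrow> 'a" (infixl "\<oplus>" 65)
    and neg :: "'a \<Rightarrow> 'a" ("\<sim> _" [80] 80)
    and zero :: 'a ("\<zero>")
  assumes plus_closed [simp]: "x \<in> C \<Longrightarrow> y \<in> C \<Longrightarrow> x \<oplus> y \<in> C"
    and neg_closed [simp]: "x \<in> C \<Longrightarrow> \<sim> x \<in> C"
    and zero_closed [simp]: "\<zero> \<in> C"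
    and assoc: "x \<in> C \<Longrightarrow> y \<in> C \<Longrightarrow> z \<in> C \<Longrightarrow> x \<oplus> y \<oplus> z = x \<oplus> (y \<oplus> z)"
    and comm: "x \<in> C \<Longrightarrow> y \<in> C \<Longrightarrow> x \<oplus> y = y \<oplus> x"
    and plus_zero [simp]: "x \<in> C \<Longrightarrow> x \<oplus> \<zero> = x"
    and neg_neg [simp]: "x \<in> C \<Longrightarrow> \<sim> \<sim> x = x"
    and plus_one [simp]: "x \<in> C \<Longrightarrow> x \<oplus> \<sim> \<zero> = \<sim> \<zero>"
    and lukasiewicz: "x \<in> C \<Longrightarrow> y \<in> C \<Longrightarrow> \<sim> (\<sim> x \<oplus> y) \<oplus> y = \<sim> (\<sim> y \<oplus> x) \<oplus> x"
begin

text \<open>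
  The order is \<open>x \<sqsubseteq> y\<close> iff \<open>x \<rightarrow> y\<close>, which is \<open>\<sim> x \<oplus> y\<close>, equals 1; the join is \<open>(x \<rightarrow> y) \<rightarrow> y\<close>.
\<close>

definition one :: 'a ("\<one>") where "\<one> = \<sim> \<zero>"
definition times :: "'a \<Rightarrow> 'a \<Rightarrow> 'a" (infixl "\<otimes>" 70) where "x \<otimes> y = \<sim> (\<sim> x \<oplus> \<sim> y)"
definition le :: "'a \<Rightarrow> 'a \<Rightarrow> bool" (infix "\<sqsubseteq>" 50) where "x \<sqsubseteq> y \<longleftrightarrow> \<sim> x \<oplus> y = \<one>"
definition join :: "'a \<Rightarrow> 'a \<Rightarrow> 'a" (infixl "\<squnion>" 65) where "x \<squnion> y = \<sim> (\<sim> x \<oplus> y) \<oplus> y"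

lemma left_comm: "x \<in> C \<Longrightarrow> y \<in> C \<Longrightarrow> z \<in> C \<Longrightarrow> x \<oplus> (y \<oplus> z) = y \<oplus> (x \<oplus> z)"
  by (metis assoc comm)

lemmas ac = assoc comm left_comm

lemma one_closed [simp]: "\<one> \<in> C" by (simp add: one_def)
lemma times_closed [simp]: "x \<in> C \<Longrightarrow> y \<in> C \<Longrightarrow> x \<otimes> y \<in> C" by (simp add: times_def)
lemma join_closed [simp]: "x \<in> C \<Longrightarrow> y \<in> C \<Longrightarrow> x \<squnion> y \<in> C" by (simp add: join_def)
lemma neg_one [simp]: "\<sim> \<one> = \<zero>" by (simp add: one_def)
lemma neg_zero [simp]: "\<sim> \<zero> = \<one>" by (simp add: one_def)
lemma plus_one' [simp]: "x \<in> C \<Longrightarrow> x \<oplus> \<one> = \<one>" "x \<in> C \<Longrightarrow> \<one> \<oplus> x = \<one>"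
  using plus_one[of x] comm[of \<one> x] by simp_all
lemma zero_plus [simp]: "x \<in> C \<Longrightarrow> \<zero> \<oplus> x = x"
  using comm[of \<zero> x] by simp
lemma plus_neg [simp]: "x \<in> C \<Longrightarrow> x \<oplus> \<sim> x = \<one>" "x \<in> C \<Longrightarrow> \<sim> x \<oplus> x = \<one>"
  using lukasiewicz[of x \<one>] comm[of x "\<sim> x"] by simp_all
lemma plus_neg_left [simp]: "x \<in> C \<Longrightarrow> y \<in> C \<Longrightarrow> x \<oplus> (\<sim> x \<oplus> y) = \<one>"
  by (simp add: assoc[symmetric])
lemma times_comm: "x \<in> C \<Longrightarrow> y \<in> C \<Longrightarrow> x \<otimes> y = y \<otimes> x"
  by (simp add: times_def comm)
lemma times_assoc: "x \<in> C \<Longrightarrow> y \<in> C \<Longrightarrow> z \<in> C \<Longrightarrow> x \<otimes> y \<otimes> z = x \<otimes> (y \<otimes> z)"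
  by (simp add: times_def assoc)
lemma neg_times: "x \<in> C \<Longrightarrow> y \<in> C \<Longrightarrow> \<sim> (x \<otimes> y) = \<sim> x \<oplus> \<sim> y"
  by (simp add: times_def)
lemma neg_plus: "x \<in> C \<Longrightarrow> y \<in> C \<Longrightarrow> \<sim> (x \<oplus> y) = \<sim> x \<otimes> \<sim> y"
  by (simp add: times_def)
lemma times_one [simp]: "x \<in> C \<Longrightarrow> x \<otimes> \<one> = x" "x \<in> C \<Longrightarrow> \<one> \<otimes> x = x"
  by (simp_all add: times_def)

lemma join_commute: "x \<in> C \<Longrightarrow> y \<in> C \<Longrightarrow> x \<squnion> y = y \<squnion> x"
  by (simp add: join_def lukasiewicz)

lemma join_absorb: "x \<in> C \<Longrightarrow> y \<in> C \<Longrightarrow> x \<sqsubseteq> y \<Longrightarrow> x \<squnion> y = y"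
  by (simp add: join_def le_def)

lemma le_refl [simp]: "x \<in> C \<Longrightarrow> x \<sqsubseteq> x" by (simp add: le_def)

lemma le_plus [simp]: "x \<in> C \<Longrightarrow> w \<in> C \<Longrightarrow> x \<sqsubseteq> x \<oplus> w"
  by (simp add: le_def assoc[symmetric])

lemma le_plus' [simp]: "x \<in> C \<Longrightarrow> w \<in> C \<Longrightarrow> x \<sqsubseteq> w \<oplus> x"
  by (metis comm le_plus)

lemma le_iff_plus: "x \<in> C \<Longrightarrow> y \<in> C \<Longrightarrow> x \<sqsubseteq> y \<longleftrightarrow> (\<exists>w \<in> C. y = x \<oplus> w)"
proof
  assume C: "x \<in> C" "y \<in> C" and "x \<sqsubseteq> y"
  then have "y = y \<squnion> x" using join_absorb join_commute by simp
  also have "\<dots> = x \<oplus> \<sim> (\<sim> y \<oplus> x)" unfolding join_def using C by (intro comm) simp_all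
  finally have "y = x \<oplus> \<sim> (\<sim> y \<oplus> x)" .
  then show "\<exists>w \<in> C. y = x \<oplus> w" using C by (metis neg_closed plus_closed)
qed auto

lemma le_trans: "x \<in> C \<Longrightarrow> y \<in> C \<Longrightarrow> z \<in> C \<Longrightarrow> x \<sqsubseteq> y \<Longrightarrow> y \<sqsubseteq> z \<Longrightarrow> x \<sqsubseteq> z"
  by (metis assoc le_iff_plus le_plus plus_closed)

lemma plus_mono: "x \<in> C \<Longrightarrow> y \<in> C \<Longrightarrow> z \<in> C \<Longrightarrow> x \<sqsubseteq> y \<Longrightarrow> x \<oplus> z \<sqsubseteq> y \<oplus> z"
  unfolding le_iff_plus[of x y] by (auto simp: ac le_iff_plus)

lemma le_neg_iff: "x \<in> C \<Longrightarrow> y \<in> C \<Longrightarrow> \<sim> y \<sqsubseteq> \<sim> x \<longleftrightarrow> x \<sqsubseteq> y"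
  by (simp add: le_def comm)

lemma one_le: "x \<in> C \<Longrightarrow> \<one> \<sqsubseteq> x \<longleftrightarrow> x = \<one>" by (simp add: le_def)

lemma times_le: "x \<in> C \<Longrightarrow> y \<in> C \<Longrightarrow> x \<otimes> y \<sqsubseteq> x"
  by (simp add: le_def neg_times ac)

lemma le_join:
  assumes "x \<in> C" "y \<in> C" shows "y \<sqsubseteq> x \<squnion> y" "x \<sqsubseteq> x \<squnion> y"
proof -
  show "y \<sqsubseteq> x \<squnion> y" using assms by (simp add: join_def)
  show "x \<sqsubseteq> x \<squnion> y" using assms join_commute[of x y] by (simp add: join_def)
qed

lemma join_least:
  assumes "x \<in> C" "y \<in> C" "z \<in> C" "x \<sqsubseteq> z" "y \<sqsubseteq> z" shows "x \<squnion> y \<sqsubseteq> z"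
proof -
  have "\<sim> z \<oplus> y \<sqsubseteq> \<sim> x \<oplus> y" using assms by (simp add: plus_mono le_neg_iff)
  then have "\<sim> (\<sim> x \<oplus> y) \<oplus> y \<sqsubseteq> \<sim> (\<sim> z \<oplus> y) \<oplus> y" using assms by (simp add: plus_mono le_neg_iff)
  then have "x \<squnion> y \<sqsubseteq> z \<squnion> y" by (simp add: join_def)
  also have "z \<squnion> y = z" using assms by (metis join_absorb join_commute)
  finally show ?thesis .
qed

text \<open>
  For fixed \<open>c\<close>, the elements whose join with \<open>c\<close> is 1 form a filter.
\<close>

lemma join_modus_ponens:
  assumes "x \<in> C" "y \<in> C" "c \<in> C" and "x \<squnion> c = \<one>" and "(\<sim> x \<oplus> y) \<squnion> c = \<one>"
  shows "y \<squnion> c = \<one>"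
proof -
  have 1: "c \<sqsubseteq> z \<oplus> (y \<squnion> c)" if "z \<in> C" for z
    using assms that by (meson join_closed le_join(1) le_plus' le_trans plus_closed)
  have "\<sim> x \<oplus> y \<sqsubseteq> \<sim> x \<oplus> (y \<squnion> c)"
    using assms plus_mono[of y "y \<squnion> c" "\<sim> x"] le_join by (simp add: comm)
  then have "(\<sim> x \<oplus> y) \<squnion> c \<sqsubseteq> \<sim> x \<oplus> (y \<squnion> c)" using assms by (intro join_least 1) auto
  then have "x \<sqsubseteq> y \<squnion> c" using assms by (simp add: one_le le_def)
  then have "x \<squnion> c \<sqsubseteq> y \<squnion> c" using assms le_join by (intro join_least) auto
  then show ?thesis using assms by (simp add: one_le)
qed

text \<open>
  Writing \<open>c = x \<rightarrow> y\<close>, \<open>b = y \<rightarrow> x\<close> and \<open>d = x \<squnion> y\<close>, one has \<open>y = c \<otimes> d\<close> and \<open>d \<rightarrow> x = b\<close>.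
  Hence \<open>b = (c \<otimes> d) \<rightarrow> x = c \<rightarrow> (d \<rightarrow> x) = c \<rightarrow> b\<close>, that is, \<open>c \<squnion> b = b \<rightarrow> b = 1\<close>.
\<close>

lemma prelinear:
  assumes "x \<in> C" "y \<in> C"
  shows "(\<sim> x \<oplus> y) \<squnion> (\<sim> y \<oplus> x) = \<one>"
proof -
  define c where "c = \<sim> x \<oplus> y"
  define b where "b = \<sim> y \<oplus> x"
  define d where "d = x \<squnion> y"
  have C: "c \<in> C" "b \<in> C" "d \<in> C" using assms by (simp_all add: c_def b_def d_def)
  have "\<sim> c \<sqsubseteq> \<sim> y" using assms by (simp add: c_def le_neg_iff)
  then have "\<sim> y \<squnion> \<sim> c = \<sim> y" using assms C by (metis join_absorb join_commute neg_closed)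
  then have y: "\<sim> c \<oplus> \<sim> d = \<sim> y"
    using assms C by (simp add: d_def join_def c_def[symmetric] comm)
  have "x \<sqsubseteq> b" using assms by (simp add: b_def)
  then have "b \<squnion> x = b" using assms C by (metis join_absorb join_commute)
  then have d: "\<sim> d \<oplus> x = b"
    using assms join_commute[of x y] by (simp add: d_def join_def b_def)
  have "\<sim> c \<oplus> b = \<sim> c \<oplus> \<sim> d \<oplus> x" using assms C by (simp add: d assoc)
  also have "\<dots> = b" by (simp add: y b_def)
  finally have "c \<squnion> b = \<one>" using C by (simp add: join_def)
  then show ?thesis by (simp add: c_def b_def)
qed

lemma times_plus_neg_cancel:
  assumes "x \<in> C" "y \<in> C" "x \<oplus> y = \<one>" shows "x \<otimes> y \<oplus> \<sim> y = x"
proof -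
  have "\<sim> y \<sqsubseteq> x" using assms by (simp add: le_def comm)
  then show ?thesis using assms join_absorb[of "\<sim> y" x] join_commute[of x "\<sim> y"]
    by (simp add: times_def join_def)
qed

lemma plus_neg_times_cancel:
  assumes "x \<in> C" "y \<in> C" "x \<sqsubseteq> y" shows "(x \<oplus> \<sim> y) \<otimes> y = x"
proof -
  have "\<sim> x \<otimes> y \<oplus> \<sim> y = \<sim> x" using assms times_plus_neg_cancel[of "\<sim> x" y] by (simp add: le_def)
  then show ?thesis using assms by (metis neg_neg neg_closed neg_plus neg_times times_closed)
qed

text \<open>
  With \<open>\<oplus>\<close> read as addition without carry and \<open>x \<otimes> y\<close> as \<open>x + y - 1\<close>, the next three lemmas say
  that adding three elements gives the same result in either bracketing. The equations assumed
  tell which of the sums \<open>x + y\<close> and \<open>y + z\<close> are at least 1 or at most 1.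
\<close>

lemma times_plus_assoc:
  assumes "x \<in> C" "y \<in> C" "z \<in> C" "x \<oplus> y = \<one>" "y \<oplus> z = \<one>"
  shows "x \<otimes> y \<oplus> z = x \<oplus> y \<otimes> z"
proof -
  have "z \<oplus> y = \<one>" using assms comm by simp
  then have "z = \<sim> y \<oplus> y \<otimes> z"
    using assms times_plus_neg_cancel[of z y] by (simp add: times_comm comm)
  then have "x \<otimes> y \<oplus> z = x \<otimes> y \<oplus> \<sim> y \<oplus> y \<otimes> z" using assms by (simp add: assoc)
  then show ?thesis using assms times_plus_neg_cancel by simp
qed

lemma plus_times_assoc:
  assumes "x \<in> C" "y \<in> C" "z \<in> C" "x \<otimes> y = \<zero>" "y \<otimes> z = \<zero>"
  shows "(x \<oplus> y) \<otimes> z = x \<otimes> (y \<oplus> z)"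
proof -
  have "\<sim> x \<oplus> \<sim> y = \<one>" "\<sim> y \<oplus> \<sim> z = \<one>" using assms by (metis neg_times neg_zero)+
  then have "\<sim> x \<otimes> \<sim> y \<oplus> \<sim> z = \<sim> x \<oplus> \<sim> y \<otimes> \<sim> z" using assms times_plus_assoc by simp
  then show ?thesis using assms by (simp add: times_def)
qed

lemma times_plus_exchange:
  assumes C: "x \<in> C" "y \<in> C" "z \<in> C" and xy: "x \<oplus> y = \<one>" and yz: "y \<otimes> z = \<zero>"
  shows "x \<otimes> y \<oplus> z = x \<otimes> (y \<oplus> z)"
proof -
  have "\<sim> y \<oplus> \<sim> z = \<one>" using C yz by (metis neg_times neg_zero)
  then have "z \<sqsubseteq> \<sim> y" using C by (simp add: le_def comm)
  then have "\<sim> y \<squnion> z = \<sim> y" using C by (metis join_absorb join_commute neg_closed)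
  then have "z \<oplus> \<sim> (y \<oplus> z) = \<sim> y" using C by (simp add: join_def comm)
  then have x: "x \<otimes> y \<oplus> z \<oplus> \<sim> (y \<oplus> z) = x"
    using C xy times_plus_neg_cancel by (simp add: assoc)
  have "x \<otimes> y \<oplus> z \<sqsubseteq> y \<oplus> z"
    using C times_le[of y x] by (intro plus_mono) (simp_all add: times_comm)
  then have "(x \<otimes> y \<oplus> z \<oplus> \<sim> (y \<oplus> z)) \<otimes> (y \<oplus> z) = x \<otimes> y \<oplus> z"
    using C by (intro plus_neg_times_cancel) auto
  then show ?thesis by (simp add: x)
qed

end

section \<open>Real-valued homomorphisms of MV-chains\<close>

text \<open>A nontrivial MV-algebra that is linearly ordered.\<close>

locale mv_chain = mv_algebra +
  assumes total: "x \<in> C \<Longrightarrow> y \<in> C \<Longrightarrow> x \<sqsubseteq> y \<or> y \<sqsubseteq> x"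
    and nontrivial: "\<zero> \<noteq> \<one>"
begin

lemma times_eq_zero: "x \<in> C \<Longrightarrow> y \<in> C \<Longrightarrow> x \<oplus> y \<noteq> \<one> \<Longrightarrow> x \<otimes> y = \<zero>"
  using total[of "\<sim> x" y] by (simp add: le_def times_def comm)

lemma times_neq_one: "x \<in> C \<Longrightarrow> y \<in> C \<Longrightarrow> x \<noteq> \<one> \<Longrightarrow> x \<otimes> y \<noteq> \<one>"
  using times_le[of x y] by (auto simp: one_le)

text \<open>
  The pair \<open>(n, x)\<close> stands for \<open>n + x\<close>, where \<open>x\<close> is a fractional part, hence different from 1.
  With addition carrying into the first component these pairs form a commutative monoid, the
  positive cone of Chang's group of the chain; the group itself is not needed.
\<close>

definition chang :: "(nat \<times> 'a) set" where "chang = UNIV \<times> (C - {\<one>})"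

definition cadd :: "nat \<times> 'a \<Rightarrow> nat \<times> 'a \<Rightarrow> nat \<times> 'a" where
  "cadd g h = (if snd g \<oplus> snd h = \<one> then (fst g + fst h + 1, snd g \<otimes> snd h)
               else (fst g + fst h, snd g \<oplus> snd h))"

lemma cadd_closed: "g \<in> chang \<Longrightarrow> h \<in> chang \<Longrightarrow> cadd g h \<in> chang"
  by (auto simp: chang_def cadd_def times_neq_one)

lemma cadd_comm: "g \<in> chang \<Longrightarrow> h \<in> chang \<Longrightarrow> cadd g h = cadd h g"
  by (auto simp: chang_def cadd_def comm times_comm)

lemma cadd_assoc:
  assumes "g \<in> chang" "h \<in> chang" "k \<in> chang"
  shows "cadd (cadd g h) k = cadd g (cadd h k)"
proof -
  obtain l x m y n z where g: "g = (l, x)" and h: "h = (m, y)" and k: "k = (n, z)"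
    by (metis surj_pair)
  have C: "x \<in> C" "y \<in> C" "z \<in> C" and 1: "x \<noteq> \<one>" "y \<noteq> \<one>" "z \<noteq> \<one>"
    using assms by (auto simp: chang_def g h k)
  show ?thesis
  proof (cases "x \<oplus> y = \<one>"; cases "y \<oplus> z = \<one>")
    assume xy: "x \<oplus> y = \<one>" and yz: "y \<oplus> z = \<one>"
    have "x \<otimes> y \<oplus> z = x \<oplus> y \<otimes> z" using C xy yz by (rule times_plus_assoc)
    then show ?thesis using C xy yz by (simp add: g h k cadd_def times_assoc)
  next
    assume xy: "x \<oplus> y = \<one>" and yz: "y \<oplus> z \<noteq> \<one>"
    have x1: "x \<oplus> (y \<oplus> z) = \<one>" using C xy by (simp add: assoc[symmetric])
    have e: "x \<otimes> y \<oplus> z = x \<otimes> (y \<oplus> z)" using C xy yz by (intro times_plus_exchange times_eq_zero)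
    have "x \<otimes> (y \<oplus> z) \<noteq> \<one>" using C 1 by (simp add: times_neq_one)
    then show ?thesis using C xy yz x1 e by (simp add: g h k cadd_def)
  next
    assume xy: "x \<oplus> y \<noteq> \<one>" and yz: "y \<oplus> z = \<one>"
    have x1: "x \<oplus> y \<oplus> z = \<one>" using C yz by (simp add: assoc)
    have "z \<otimes> y \<oplus> x = z \<otimes> (y \<oplus> x)"
      using C xy yz by (intro times_plus_exchange times_eq_zero) (simp_all add: comm)
    then have e: "x \<oplus> y \<otimes> z = (x \<oplus> y) \<otimes> z" using C by (simp add: comm times_comm)
    have "(x \<oplus> y) \<otimes> z \<noteq> \<one>" using C xy by (simp add: times_neq_one)
    then show ?thesis using C xy yz x1 e by (simp add: g h k cadd_def)
  next
    assume xy: "x \<oplus> y \<noteq> \<one>" and yz: "y \<oplus> z \<noteq> \<one>"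
    have "(x \<oplus> y) \<otimes> z = x \<otimes> (y \<oplus> z)" using C xy yz by (intro plus_times_assoc times_eq_zero)
    then show ?thesis using C xy yz by (simp add: g h k cadd_def assoc)
  qed
qed

abbreviation dbl :: "nat \<times> 'a \<Rightarrow> nat \<times> 'a" where "dbl g \<equiv> cadd g g"

lemma dbl_pow_closed: "g \<in> chang \<Longrightarrow> (dbl ^^ n) g \<in> chang"
  by (induction n) (simp_all add: cadd_closed)

lemma dbl_pow_cadd:
  assumes "g \<in> chang" "h \<in> chang"
  shows "(dbl ^^ n) (cadd g h) = cadd ((dbl ^^ n) g) ((dbl ^^ n) h)"
proof (induction n)
  case (Suc n)
  have "cadd (cadd a b) (cadd a b) = cadd (cadd a a) (cadd b b)" if "a \<in> chang" "b \<in> chang" for a b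
    using that by (metis cadd_assoc cadd_closed cadd_comm)
  then show ?case using Suc assms by (simp add: dbl_pow_closed)
qed simp

lemma fst_cadd: "fst g + fst h \<le> fst (cadd g h)" "fst (cadd g h) \<le> fst g + fst h + 1"
  by (simp_all add: cadd_def)

text \<open>
  The value of \<open>g\<close> relative to the unit \<open>(1, 0)\<close>: the limit of \<open>\<lfloor>2\<^sup>n g\<rfloor> / 2\<^sup>n\<close>. The carry in a sum is at
  most 1, so these approximations increase, converge, and are additive up to \<open>1 / 2\<^sup>n\<close>.
\<close>

definition slope_approx :: "nat \<times> 'a \<Rightarrow> nat \<Rightarrow> real"
  where "slope_approx g n = real (fst ((dbl ^^ n) g)) / 2 ^ n"

definition slope :: "nat \<times> 'a \<Rightarrow> real" where "slope g = lim (slope_approx g)"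

lemma slope_approx_tendsto: "slope_approx g \<longlonglongrightarrow> slope g"
proof -
  have step: "slope_approx g n \<le> slope_approx g (Suc n)"
    "slope_approx g (Suc n) \<le> slope_approx g n + (1/2) ^ Suc n" for n
    using fst_cadd[of "(dbl ^^ n) g" "(dbl ^^ n) g"]
    by (simp_all add: slope_approx_def field_simps)
  have "slope_approx g n \<le> fst g + 1 - (1/2) ^ n" for n
  proof (induction n)
    case (Suc n)
    then show ?case using step(2)[of n] by simp
  qed (simp add: slope_approx_def)
  then have bd: "slope_approx g n \<le> fst g + 1" for n
    by (smt (verit) zero_le_power divide_nonneg_nonneg)
  have "incseq (slope_approx g)" using step(1) by (rule incseq_SucI)
  then have "convergent (slope_approx g)" using bd incseq_convergent
    by (metis convergentI)
  then show ?thesis unfolding slope_def by (simp add: convergent_LIMSEQ_iff)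
qed

lemma slope_nonneg: "0 \<le> slope g"
  by (rule LIMSEQ_le_const[OF slope_approx_tendsto]) (simp add: slope_approx_def)

lemma slope_cadd:
  assumes "g \<in> chang" "h \<in> chang"
  shows "slope (cadd g h) = slope g + slope h"
proof -
  have "slope_approx (cadd g h) n - (slope_approx g n + slope_approx h n) \<in> {0..(1/2) ^ n}" for n
  proof -
    define a b c where "a = real (fst ((dbl ^^ n) g))" and "b = real (fst ((dbl ^^ n) h))"
      and "c = real (fst (cadd ((dbl ^^ n) g) ((dbl ^^ n) h)))"
    have "0 \<le> c - (a + b)" "c - (a + b) \<le> 1"
      using fst_cadd[of "(dbl ^^ n) g" "(dbl ^^ n) h"] unfolding a_def b_def c_def by linarith+
    then have "(c - (a + b)) / 2 ^ n \<in> {0..1 / 2 ^ n}" by (simp add: divide_right_mono)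
    then show ?thesis
      using dbl_pow_cadd[OF assms, of n]
      by (simp add: slope_approx_def a_def b_def c_def diff_divide_distrib add_divide_distrib power_one_over)
  qed
  then have "(\<lambda>n. slope_approx (cadd g h) n - (slope_approx g n + slope_approx h n)) \<longlonglongrightarrow> 0"
    by (intro tendsto_sandwich[OF _ _ tendsto_const LIMSEQ_realpow_zero[of "1/2"]]) auto
  moreover have "(\<lambda>n. slope_approx (cadd g h) n - (slope_approx g n + slope_approx h n))
      \<longlonglongrightarrow> slope (cadd g h) - (slope g + slope h)"
    by (intro tendsto_intros slope_approx_tendsto)
  ultimately show ?thesis using LIMSEQ_unique by fastforce
qed

lemma slope_unit: "slope (1, \<zero>) = 1"
proof -
  have "(dbl ^^ n) (1, \<zero>) = (2 ^ n, \<zero>)" for n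
    by (induction n) (simp_all add: cadd_def nontrivial)
  then have "slope_approx (1, \<zero>) = (\<lambda>n. 1)" by (simp add: slope_approx_def fun_eq_iff)
  then have "(\<lambda>n. 1) \<longlonglongrightarrow> slope (1, \<zero>)" using slope_approx_tendsto[of "(1, \<zero>)"] by simp
  then show ?thesis unfolding LIMSEQ_const_iff by (rule sym)
qed

text \<open>
  The element 1 is no fractional part; it corresponds to \<open>1 + 0\<close>.
\<close>

definition embed :: "'a \<Rightarrow> nat \<times> 'a" where "embed x = (if x = \<one> then (1, \<zero>) else (0, x))"

text \<open>
  The homomorphism to \<open>[0,1]\<close>. It identifies elements of the chain that differ by an infinitesimal.
\<close>

definition hom :: "'a \<Rightarrow> real" where "hom x = slope (embed x)"

lemma hom_one: "hom \<one> = 1" using slope_unit by (simp add: hom_def embed_def)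

lemma hom_nonneg: "0 \<le> hom x" by (simp add: hom_def slope_nonneg)

lemma hom_add:
  assumes C: "x \<in> C" "y \<in> C" and 0: "x \<otimes> y = \<zero>"
  shows "hom (x \<oplus> y) = hom x + hom y"
proof -
  have "embed (x \<oplus> y) = cadd (embed x) (embed y)"
  proof (cases "x = \<one> \<or> y = \<one>")
    case True
    then have "x = \<one> \<and> y = \<zero> \<or> x = \<zero> \<and> y = \<one>" using C 0 by (metis times_one)
    then show ?thesis using nontrivial by (auto simp: embed_def cadd_def)
  next
    case False
    then show ?thesis using 0 by (simp add: embed_def cadd_def)
  qed
  then show ?thesis using C nontrivial by (simp add: hom_def slope_cadd embed_def chang_def)
qed

lemma hom_neg: "x \<in> C \<Longrightarrow> hom (\<sim> x) = 1 - hom x"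
  using hom_add[of x "\<sim> x"] by (simp add: times_def hom_one)

lemma hom_le_one: "x \<in> C \<Longrightarrow> hom x \<le> 1"
  using hom_neg[of x] hom_nonneg[of "\<sim> x"] by simp

text \<open>
  If \<open>x \<sqsubseteq> y\<close> then \<open>y\<close> is the carry-free sum of \<open>x\<close> and \<open>y \<otimes> \<sim> x\<close>.
\<close>

lemma hom_mono:
  assumes C: "x \<in> C" "y \<in> C" and "x \<sqsubseteq> y" shows "hom x \<le> hom y"
proof -
  let ?w = "\<sim> (\<sim> y \<oplus> x)"
  have "x \<squnion> y = y" using assms by (simp add: join_absorb)
  then have y: "y = x \<oplus> ?w" using C join_commute[of x y] by (simp add: join_def comm)
  have "x \<otimes> ?w = \<zero>" using C by (simp add: times_def ac)
  then have "hom (x \<oplus> ?w) = hom x + hom ?w" using C by (intro hom_add) auto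
  then have "hom y = hom x + hom ?w" using y by simp
  then show ?thesis using hom_nonneg[of ?w] by simp
qed

lemma hom_plus:
  assumes C: "x \<in> C" "y \<in> C" shows "hom (x \<oplus> y) = min (hom x + hom y) 1"
proof (cases "x \<oplus> y = \<one>")
  case True
  then have "\<sim> y \<sqsubseteq> x" using C by (simp add: le_def comm)
  then have "1 - hom y \<le> hom x" using C hom_mono[of "\<sim> y" x] by (simp add: hom_neg)
  then show ?thesis using True by (simp add: hom_one)
next
  case False
  then show ?thesis using C hom_add[of x y] hom_le_one[of "x \<oplus> y"] by (simp add: times_eq_zero)
qed

lemma hom_plus_neq_one: "x \<in> C \<Longrightarrow> y \<in> C \<Longrightarrow> x \<oplus> y \<noteq> \<one> \<Longrightarrow> hom x + hom y \<le> 1"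
  using hom_add[of x y] hom_le_one[of "x \<oplus> y"] by (simp add: times_eq_zero)

end

section \<open>Theories of Lukasiewicz logic and their Lindenbaum algebras\<close>

text \<open>
  A set of formulas containing all instances of the axioms of Lukasiewicz logic and closed under
  modus ponens. Closure under substitution or necessitation is not required, so that the theories
  arising from a world are covered.
\<close>

locale lukasiewicz_theory =
  fixes T :: "'p mform set"
  assumes modus_ponens: "\<phi> \<in> T \<Longrightarrow> \<phi> \<^bold>\<rightarrow> \<psi> \<in> T \<Longrightarrow> \<psi> \<in> T"
    and imp_K: "\<phi> \<^bold>\<rightarrow> (\<psi> \<^bold>\<rightarrow> \<phi>) \<in> T"
    and imp_B: "(\<phi> \<^bold>\<rightarrow> \<psi>) \<^bold>\<rightarrow> ((\<psi> \<^bold>\<rightarrow> \<chi>) \<^bold>\<rightarrow> (\<phi> \<^bold>\<rightarrow> \<chi>)) \<in> T"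
    and imp_join: "((\<phi> \<^bold>\<rightarrow> \<psi>) \<^bold>\<rightarrow> \<psi>) \<^bold>\<rightarrow> ((\<psi> \<^bold>\<rightarrow> \<phi>) \<^bold>\<rightarrow> \<phi>) \<in> T"
    and imp_contra: "(\<^bold>\<not> \<phi> \<^bold>\<rightarrow> \<^bold>\<not> \<psi>) \<^bold>\<rightarrow> (\<psi> \<^bold>\<rightarrow> \<phi>) \<in> T"
    and plus_iff: "((\<phi> \<^bold>\<oplus> \<psi>) \<^bold>\<leftrightarrow> (\<^bold>\<not> \<psi> \<^bold>\<rightarrow> \<phi>)) \<in> T"
begin

lemma imp_trans: "\<phi> \<^bold>\<rightarrow> \<psi> \<in> T \<Longrightarrow> \<psi> \<^bold>\<rightarrow> \<chi> \<in> T \<Longrightarrow> \<phi> \<^bold>\<rightarrow> \<chi> \<in> T"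
  using imp_B modus_ponens by blast

lemma imp_theorem: "\<psi> \<in> T \<Longrightarrow> \<phi> \<^bold>\<rightarrow> \<psi> \<in> T"
  using imp_K modus_ponens by blast

lemma theorem_imp: "\<tau> \<in> T \<Longrightarrow> (\<tau> \<^bold>\<rightarrow> \<phi>) \<^bold>\<rightarrow> \<phi> \<in> T"
  by (meson imp_join imp_theorem modus_ponens)

lemma imp_refl: "\<phi> \<^bold>\<rightarrow> \<phi> \<in> T"
  by (meson imp_K imp_trans theorem_imp)

lemma imp_apply: "\<phi> \<^bold>\<rightarrow> ((\<phi> \<^bold>\<rightarrow> \<psi>) \<^bold>\<rightarrow> \<psi>) \<in> T"
  by (meson imp_K imp_join imp_trans)

lemma imp_exchange: "\<phi> \<^bold>\<rightarrow> (\<psi> \<^bold>\<rightarrow> \<chi>) \<in> T \<Longrightarrow> \<psi> \<^bold>\<rightarrow> (\<phi> \<^bold>\<rightarrow> \<chi>) \<in> T"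
  by (meson imp_B modus_ponens imp_apply imp_trans)

lemma imp_mono: "\<psi> \<^bold>\<rightarrow> \<chi> \<in> T \<Longrightarrow> (\<phi> \<^bold>\<rightarrow> \<psi>) \<^bold>\<rightarrow> (\<phi> \<^bold>\<rightarrow> \<chi>) \<in> T"
  by (meson imp_B imp_exchange modus_ponens)

lemma imp_antimono: "\<phi> \<^bold>\<rightarrow> \<psi> \<in> T \<Longrightarrow> (\<psi> \<^bold>\<rightarrow> \<chi>) \<^bold>\<rightarrow> (\<phi> \<^bold>\<rightarrow> \<chi>) \<in> T"
  by (meson imp_B modus_ponens)

text \<open>
  There is no contraction; the chain
  \<open>\<not>\<not>\<phi> \<rightarrow> (\<not>\<not>\<tau> \<rightarrow> \<not>\<not>\<phi>) \<rightarrow> (\<not>\<phi> \<rightarrow> \<not>\<tau>) \<rightarrow> (\<tau> \<rightarrow> \<phi>) \<rightarrow> \<phi>\<close> of provable implications, with a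
  theorem \<open>\<tau>\<close>, replaces the usual argument.
\<close>

lemma dneg_elim: "\<^bold>\<not> \<^bold>\<not> \<phi> \<^bold>\<rightarrow> \<phi> \<in> T"
proof -
  obtain \<tau> where "\<tau> \<in> T" using imp_refl by blast
  then have "(\<tau> \<^bold>\<rightarrow> \<phi>) \<^bold>\<rightarrow> \<phi> \<in> T" by (rule theorem_imp)
  moreover have "\<^bold>\<not> \<^bold>\<not> \<phi> \<^bold>\<rightarrow> (\<^bold>\<not> \<^bold>\<not> \<tau> \<^bold>\<rightarrow> \<^bold>\<not> \<^bold>\<not> \<phi>) \<in> T" by (rule imp_K)
  ultimately show ?thesis by (meson imp_contra imp_trans)
qed

lemma dneg_intro: "\<phi> \<^bold>\<rightarrow> \<^bold>\<not> \<^bold>\<not> \<phi> \<in> T"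
  by (meson dneg_elim imp_contra modus_ponens)

lemma contrapos: "(\<phi> \<^bold>\<rightarrow> \<psi>) \<^bold>\<rightarrow> (\<^bold>\<not> \<psi> \<^bold>\<rightarrow> \<^bold>\<not> \<phi>) \<in> T"
  by (meson dneg_elim dneg_intro imp_antimono imp_contra imp_mono imp_trans)

lemma ex_falso: "\<^bold>\<not> \<phi> \<^bold>\<rightarrow> (\<phi> \<^bold>\<rightarrow> \<psi>) \<in> T"
  by (meson imp_K imp_contra imp_trans)

lemma times_mem_iff: "\<phi> \<^bold>\<odot> \<psi> \<in> T \<longleftrightarrow> \<phi> \<in> T \<and> \<psi> \<in> T"
proof -
  have times: "\<phi> \<^bold>\<odot> \<psi> = \<^bold>\<not> (\<psi> \<^bold>\<rightarrow> \<^bold>\<not> \<phi>)" by (simp add: ftimes_def fimp_def)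
  have "\<^bold>\<not> (\<psi> \<^bold>\<rightarrow> \<^bold>\<not> \<phi>) \<^bold>\<rightarrow> \<phi> \<in> T" "\<^bold>\<not> (\<psi> \<^bold>\<rightarrow> \<^bold>\<not> \<phi>) \<^bold>\<rightarrow> \<psi> \<in> T"
    by (meson contrapos dneg_elim ex_falso imp_K imp_trans modus_ponens)+
  moreover have "\<phi> \<^bold>\<rightarrow> \<^bold>\<not> (\<psi> \<^bold>\<rightarrow> \<^bold>\<not> \<phi>) \<in> T" if "\<psi> \<in> T"
    using theorem_imp[OF that, of "\<^bold>\<not> \<phi>"] by (meson contrapos dneg_intro imp_trans modus_ponens)
  ultimately show ?thesis unfolding times by (meson modus_ponens)
qed

lemma iff_mem_iff: "(\<phi> \<^bold>\<leftrightarrow> \<psi>) \<in> T \<longleftrightarrow> \<phi> \<^bold>\<rightarrow> \<psi> \<in> T \<and> \<psi> \<^bold>\<rightarrow> \<phi> \<in> T"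
  by (simp add: fiff_def times_mem_iff)

lemma plus_imp: "\<phi> \<^bold>\<oplus> \<psi> \<^bold>\<rightarrow> (\<^bold>\<not> \<psi> \<^bold>\<rightarrow> \<phi>) \<in> T" "(\<^bold>\<not> \<psi> \<^bold>\<rightarrow> \<phi>) \<^bold>\<rightarrow> \<phi> \<^bold>\<oplus> \<psi> \<in> T"
  using plus_iff iff_mem_iff by auto

lemma plus_swap: "\<phi> \<^bold>\<oplus> \<psi> \<^bold>\<rightarrow> \<psi> \<^bold>\<oplus> \<phi> \<in> T"
  by (meson plus_imp contrapos dneg_elim imp_mono imp_trans)

lemma plus_imp': "\<phi> \<^bold>\<oplus> \<psi> \<^bold>\<rightarrow> (\<^bold>\<not> \<phi> \<^bold>\<rightarrow> \<psi>) \<in> T" "(\<^bold>\<not> \<phi> \<^bold>\<rightarrow> \<psi>) \<^bold>\<rightarrow> \<phi> \<^bold>\<oplus> \<psi> \<in> T"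
  by (meson plus_imp plus_swap imp_trans)+

lemma plus_mono_left: "\<phi> \<^bold>\<rightarrow> \<phi>' \<in> T \<Longrightarrow> \<phi> \<^bold>\<oplus> \<psi> \<^bold>\<rightarrow> \<phi>' \<^bold>\<oplus> \<psi> \<in> T"
  by (meson plus_imp imp_mono imp_trans)

lemma plus_mono_both: "\<phi> \<^bold>\<rightarrow> \<phi>' \<in> T \<Longrightarrow> \<psi> \<^bold>\<rightarrow> \<psi>' \<in> T \<Longrightarrow> \<phi> \<^bold>\<oplus> \<psi> \<^bold>\<rightarrow> \<phi>' \<^bold>\<oplus> \<psi>' \<in> T"
  by (meson plus_mono_left plus_swap imp_trans)

lemma imp_exchange_imp: "(\<phi> \<^bold>\<rightarrow> (\<psi> \<^bold>\<rightarrow> \<chi>)) \<^bold>\<rightarrow> (\<psi> \<^bold>\<rightarrow> (\<phi> \<^bold>\<rightarrow> \<chi>)) \<in> T"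
  by (meson imp_B imp_antimono imp_apply imp_trans)

lemma plus_assoc_imp: "(\<phi> \<^bold>\<oplus> \<psi>) \<^bold>\<oplus> \<chi> \<^bold>\<rightarrow> \<phi> \<^bold>\<oplus> (\<psi> \<^bold>\<oplus> \<chi>) \<in> T"
  "\<phi> \<^bold>\<oplus> (\<psi> \<^bold>\<oplus> \<chi>) \<^bold>\<rightarrow> (\<phi> \<^bold>\<oplus> \<psi>) \<^bold>\<oplus> \<chi> \<in> T"
proof -
  have 1: "(\<phi> \<^bold>\<oplus> \<psi>) \<^bold>\<oplus> \<chi> \<^bold>\<rightarrow> (\<^bold>\<not> \<chi> \<^bold>\<rightarrow> (\<^bold>\<not> \<phi> \<^bold>\<rightarrow> \<psi>)) \<in> T"
    "(\<^bold>\<not> \<chi> \<^bold>\<rightarrow> (\<^bold>\<not> \<phi> \<^bold>\<rightarrow> \<psi>)) \<^bold>\<rightarrow> (\<phi> \<^bold>\<oplus> \<psi>) \<^bold>\<oplus> \<chi> \<in> T"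
    by (rule imp_trans[OF plus_imp(1) imp_mono[OF plus_imp'(1)]],
        rule imp_trans[OF imp_mono[OF plus_imp'(2)] plus_imp(2)])
  have 2: "\<phi> \<^bold>\<oplus> (\<psi> \<^bold>\<oplus> \<chi>) \<^bold>\<rightarrow> (\<^bold>\<not> \<phi> \<^bold>\<rightarrow> (\<^bold>\<not> \<chi> \<^bold>\<rightarrow> \<psi>)) \<in> T"
    "(\<^bold>\<not> \<phi> \<^bold>\<rightarrow> (\<^bold>\<not> \<chi> \<^bold>\<rightarrow> \<psi>)) \<^bold>\<rightarrow> \<phi> \<^bold>\<oplus> (\<psi> \<^bold>\<oplus> \<chi>) \<in> T"
    by (rule imp_trans[OF plus_imp'(1) imp_mono[OF plus_imp(1)]],
        rule imp_trans[OF imp_mono[OF plus_imp(2)] plus_imp'(2)])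
  show "(\<phi> \<^bold>\<oplus> \<psi>) \<^bold>\<oplus> \<chi> \<^bold>\<rightarrow> \<phi> \<^bold>\<oplus> (\<psi> \<^bold>\<oplus> \<chi>) \<in> T" "\<phi> \<^bold>\<oplus> (\<psi> \<^bold>\<oplus> \<chi>) \<^bold>\<rightarrow> (\<phi> \<^bold>\<oplus> \<psi>) \<^bold>\<oplus> \<chi> \<in> T"
    by (rule imp_trans[OF 1(1) imp_trans[OF imp_exchange_imp 2(2)]],
        rule imp_trans[OF 2(1) imp_trans[OF imp_exchange_imp 1(2)]])
qed

text \<open>
  Operations on classes can now be computed on representatives, and the quotient is an MV-algebra.
\<close>

lemma equiv_logeq: "equiv UNIV (logeq T)"
proof (rule equivI)
  show "refl (logeq T)" by (auto simp: refl_on_def logeq_def iff_mem_iff imp_refl)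
  show "sym (logeq T)" by (auto simp: sym_def logeq_def iff_mem_iff)
  show "trans (logeq T)" unfolding trans_def logeq_def iff_mem_iff using imp_trans by blast
qed simp

lemma fcls_eq_iff: "fcls T \<phi> = fcls T \<psi> \<longleftrightarrow> \<phi> \<^bold>\<rightarrow> \<psi> \<in> T \<and> \<psi> \<^bold>\<rightarrow> \<phi> \<in> T"
  using eq_equiv_class_iff[OF equiv_logeq, of \<phi> \<psi>] by (simp add: fcls_def logeq_def iff_mem_iff)

lemma mem_fcls_iff: "\<psi> \<in> fcls T \<phi> \<longleftrightarrow> fcls T \<psi> = fcls T \<phi>"
  by (auto simp: fcls_eq_iff) (auto simp: fcls_def logeq_def iff_mem_iff)

lemma free_algE:
  assumes "X \<in> free_alg T" obtains \<phi> where "X = fcls T \<phi>"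
  using assms by (auto simp: free_alg_def fcls_def quotient_def)

lemma alg_neg_fcls: "alg_neg T (fcls T \<phi>) = fcls T (\<^bold>\<not> \<phi>)"
proof -
  have "fcls T (\<^bold>\<not> \<phi>') = fcls T (\<^bold>\<not> \<phi>)" if "\<phi>' \<in> fcls T \<phi>" for \<phi>'
    using that contrapos modus_ponens unfolding mem_fcls_iff fcls_eq_iff by blast
  moreover have "\<phi> \<in> fcls T \<phi>" by (simp add: mem_fcls_iff)
  ultimately show ?thesis unfolding alg_neg_def by blast
qed

lemma alg_plus_fcls: "alg_plus T (fcls T \<phi>) (fcls T \<psi>) = fcls T (\<phi> \<^bold>\<oplus> \<psi>)"
proof -
  have "fcls T (\<phi>' \<^bold>\<oplus> \<psi>') = fcls T (\<phi> \<^bold>\<oplus> \<psi>)" if "\<phi>' \<in> fcls T \<phi>" "\<psi>' \<in> fcls T \<psi>" for \<phi>' \<psi>'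
    using that plus_mono_both unfolding mem_fcls_iff fcls_eq_iff by blast
  moreover have "\<phi> \<in> fcls T \<phi>" "\<psi> \<in> fcls T \<psi>" by (simp_all add: mem_fcls_iff)
  ultimately show ?thesis unfolding alg_plus_def by blast
qed

lemma fcls_times_cong:
  "fcls T \<phi>' = fcls T \<phi> \<Longrightarrow> fcls T \<psi>' = fcls T \<psi> \<Longrightarrow> fcls T (\<phi>' \<^bold>\<odot> \<psi>') = fcls T (\<phi> \<^bold>\<odot> \<psi>)"
  unfolding ftimes_def by (metis alg_neg_fcls alg_plus_fcls)

lemma alg_times_fcls: "alg_times T (fcls T \<phi>) (fcls T \<psi>) = fcls T (\<phi> \<^bold>\<odot> \<psi>)"
proof -
  have "fcls T (\<phi>' \<^bold>\<odot> \<psi>') = fcls T (\<phi> \<^bold>\<odot> \<psi>)" if "\<phi>' \<in> fcls T \<phi>" "\<psi>' \<in> fcls T \<psi>" for \<phi>' \<psi>'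
    using that fcls_times_cong unfolding mem_fcls_iff by blast
  moreover have "\<phi> \<in> fcls T \<phi>" "\<psi> \<in> fcls T \<psi>" by (simp_all add: mem_fcls_iff)
  ultimately show ?thesis unfolding alg_times_def by blast
qed

lemma fcls_theorem: "\<tau> \<in> T \<Longrightarrow> fcls T \<tau> = T"
proof -
  assume \<tau>: "\<tau> \<in> T"
  have "(\<tau>, \<psi>) \<in> logeq T \<longleftrightarrow> \<psi> \<in> T" for \<psi>
    using \<tau> imp_theorem modus_ponens unfolding logeq_def mem_Collect_eq case_prod_conv iff_mem_iff
    by blast
  then show ?thesis by (auto simp: fcls_def)
qed

lemma fcls_eq_one_iff: "fcls T \<phi> = T \<longleftrightarrow> \<phi> \<in> T"
  using fcls_theorem mem_fcls_iff by blast

lemma alg_zero_fcls: "\<tau> \<in> T \<Longrightarrow> alg_zero T = fcls T (\<^bold>\<not> \<tau>)"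
  using fcls_theorem[of \<tau>] alg_neg_fcls[of \<tau>] by (simp add: alg_zero_def alg_one_def)

sublocale mv_algebra "free_alg T" "alg_plus T" "alg_neg T" "alg_zero T"
proof
  obtain \<tau> where \<tau>: "\<tau> \<in> T" using imp_refl by blast
  note cls = alg_plus_fcls alg_neg_fcls alg_zero_fcls[OF \<tau>] fcls_in_free_alg
  fix X Y Z
  assume "X \<in> free_alg T" then obtain \<phi> where X: "X = fcls T \<phi>" by (rule free_algE)
  show "alg_neg T X \<in> free_alg T" by (simp add: X cls)
  show "alg_neg T (alg_neg T X) = X"
    using dneg_intro dneg_elim by (simp add: X cls fcls_eq_iff)
  show "alg_plus T X (alg_zero T) = X"
    using theorem_imp[OF \<tau>] imp_K by (simp add: X cls fcls_eq_iff fimp_def[symmetric])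
  have "\<^bold>\<not> \<^bold>\<not> \<tau> \<in> T" using \<tau> dneg_intro modus_ponens by blast
  then have "\<phi> \<^bold>\<oplus> \<^bold>\<not> \<^bold>\<not> \<tau> \<in> T" by (meson imp_theorem modus_ponens plus_imp'(2))
  then have "fcls T (\<phi> \<^bold>\<oplus> \<^bold>\<not> \<^bold>\<not> \<tau>) = fcls T (\<^bold>\<not> \<^bold>\<not> \<tau>)"
    using fcls_theorem \<open>\<^bold>\<not> \<^bold>\<not> \<tau> \<in> T\<close> by blast
  then show "alg_plus T X (alg_neg T (alg_zero T)) = alg_neg T (alg_zero T)"
    by (simp add: X cls)
  assume "Y \<in> free_alg T" then obtain \<psi> where Y: "Y = fcls T \<psi>" by (rule free_algE)
  show "alg_plus T X Y \<in> free_alg T" by (simp add: X Y cls)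
  show "alg_plus T X Y = alg_plus T Y X" using plus_swap by (simp add: X Y cls fcls_eq_iff)
  have swap: "fcls T (\<alpha> \<^bold>\<oplus> \<beta>) = fcls T (\<beta> \<^bold>\<oplus> \<alpha>)" for \<alpha> \<beta>
    using plus_swap by (simp add: fcls_eq_iff)
  have join: "alg_plus T (alg_neg T (alg_plus T (alg_neg T (fcls T \<alpha>)) (fcls T \<beta>))) (fcls T \<beta>) =
      fcls T ((\<alpha> \<^bold>\<rightarrow> \<beta>) \<^bold>\<rightarrow> \<beta>)" for \<alpha> \<beta>
  proof -
    have "alg_plus T (alg_neg T (fcls T \<alpha>)) (fcls T \<beta>) = fcls T (\<alpha> \<^bold>\<rightarrow> \<beta>)"
      using swap[of \<beta> "\<^bold>\<not> \<alpha>"] by (simp add: cls fimp_def)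
    then show ?thesis using swap[of \<beta> "\<^bold>\<not> (\<alpha> \<^bold>\<rightarrow> \<beta>)"] by (simp add: cls fimp_def[of "\<alpha> \<^bold>\<rightarrow> \<beta>"])
  qed
  show "alg_plus T (alg_neg T (alg_plus T (alg_neg T X) Y)) Y =
      alg_plus T (alg_neg T (alg_plus T (alg_neg T Y) X)) X"
    unfolding X Y join using imp_join by (simp add: fcls_eq_iff)
  assume "Z \<in> free_alg T" then obtain \<chi> where Z: "Z = fcls T \<chi>" by (rule free_algE)
  show "alg_plus T (alg_plus T X Y) Z = alg_plus T X (alg_plus T Y Z)"
    using plus_assoc_imp by (simp add: X Y Z cls fcls_eq_iff)
next
  show "alg_zero T \<in> free_alg T" using alg_zero_fcls fcls_in_free_alg imp_refl by metis
qed

lemma one_eq: "one = T"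
proof -
  obtain \<tau> where \<tau>: "\<tau> \<in> T" using imp_refl by blast
  then have "\<^bold>\<not> \<^bold>\<not> \<tau> \<in> T" using dneg_intro modus_ponens by blast
  then show ?thesis unfolding one_def by (simp add: alg_zero_fcls[OF \<tau>] alg_neg_fcls fcls_theorem)
qed

lemma fcls_imp: "fcls T (\<phi> \<^bold>\<rightarrow> \<psi>) = alg_plus T (alg_neg T (fcls T \<phi>)) (fcls T \<psi>)"
  by (metis alg_neg_fcls alg_plus_fcls comm fcls_in_free_alg fimp_def)

lemma le_fcls_iff: "le (fcls T \<phi>) (fcls T \<psi>) \<longleftrightarrow> \<phi> \<^bold>\<rightarrow> \<psi> \<in> T"
  by (simp add: le_def one_eq fcls_imp[symmetric] fcls_eq_one_iff)

end

section \<open>Linearly ordered extensions of theories\<close>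

text \<open>A theory whose Lindenbaum algebra is linearly ordered.\<close>

definition lin_theory :: "'p mform set \<Rightarrow> bool" where
  "lin_theory T \<longleftrightarrow> lukasiewicz_theory T \<and> (\<forall>\<phi> \<psi>. \<phi> \<^bold>\<rightarrow> \<psi> \<in> T \<or> \<psi> \<^bold>\<rightarrow> \<phi> \<in> T)"

lemma lukasiewicz_theory_superset:
  assumes "lukasiewicz_theory T" "T \<subseteq> T'"
    and "\<And>\<phi> \<psi>. \<phi> \<in> T' \<Longrightarrow> \<phi> \<^bold>\<rightarrow> \<psi> \<in> T' \<Longrightarrow> \<psi> \<in> T'"
  shows "lukasiewicz_theory T'"
  using assms unfolding lukasiewicz_theory_def by blast

lemma (in lukasiewicz_theory) join_theory:
  "lukasiewicz_theory {\<phi>. join (fcls T \<phi>) (fcls T \<gamma>) = one}" (is "lukasiewicz_theory ?J")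
  "T \<subseteq> {\<phi>. join (fcls T \<phi>) (fcls T \<gamma>) = one}"
proof -
  show sub: "T \<subseteq> ?J"
    by (metis (mono_tags, lifting) fcls_in_free_alg fcls_theorem le_join(2) mem_Collect_eq one_eq
        one_le join_closed subsetI)
  show "lukasiewicz_theory ?J"
  proof (rule lukasiewicz_theory_superset[OF _ sub])
    show "lukasiewicz_theory T" by unfold_locales
    fix \<phi> \<psi> assume "\<phi> \<in> ?J" "\<phi> \<^bold>\<rightarrow> \<psi> \<in> ?J"
    then show "\<psi> \<in> ?J"
      using join_modus_ponens[of "fcls T \<phi>" "fcls T \<psi>" "fcls T \<gamma>"]
      by (simp add: fcls_imp fcls_in_free_alg)
  qed
qed

text \<open>
  For \<open>\<gamma>\<close> let \<open>J \<gamma>\<close> be the theory of all formulas whose join with \<open>\<gamma>\<close> is 1. If some formula of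
  \<open>J \<gamma>\<close> is not in \<open>T\<close>, then \<open>J \<gamma>\<close> is a proper extension of \<open>T\<close> and contains \<open>\<alpha>\<close> by maximality. If \<open>T\<close> contains
  neither \<open>\<phi> \<rightarrow> \<psi>\<close> nor \<open>\<psi> \<rightarrow> \<phi>\<close>, prelinearity and two applications of this show that the join of
  \<open>\<alpha>\<close> with itself is 1.
\<close>

lemma maximal_avoiding_lin:
  assumes T: "lukasiewicz_theory T" and "\<alpha> \<notin> T"
    and max: "\<And>T'. lukasiewicz_theory T' \<Longrightarrow> T \<subseteq> T' \<Longrightarrow> \<alpha> \<notin> T' \<Longrightarrow> T' = T"
  shows "lin_theory T"
proof -
  interpret lukasiewicz_theory T by fact
  define J where "J \<gamma> = {\<phi>. join (fcls T \<phi>) (fcls T \<gamma>) = one}" for \<gamma>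
  have J: "\<alpha> \<in> J \<gamma>" if "\<beta> \<in> J \<gamma>" "\<beta> \<notin> T" for \<beta> \<gamma>
    using max[OF join_theory] that unfolding J_def by blast
  have J_sym: "\<gamma> \<in> J \<beta>" if "\<beta> \<in> J \<gamma>" for \<beta> \<gamma>
    using that join_commute[OF fcls_in_free_alg fcls_in_free_alg, of \<beta> \<gamma>] by (simp add: J_def)
  have "\<phi> \<^bold>\<rightarrow> \<psi> \<in> T \<or> \<psi> \<^bold>\<rightarrow> \<phi> \<in> T" for \<phi> \<psi>
  proof (rule ccontr)
    assume *: "\<not> ?thesis"
    have "\<phi> \<^bold>\<rightarrow> \<psi> \<in> J (\<psi> \<^bold>\<rightarrow> \<phi>)" by (simp add: J_def fcls_imp prelinear fcls_in_free_alg)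
    then have "\<psi> \<^bold>\<rightarrow> \<phi> \<in> J \<alpha>" using * J J_sym by blast
    then have "\<alpha> \<in> J \<alpha>" using * J by blast
    then have "fcls T \<alpha> = T" by (simp add: J_def join_absorb fcls_in_free_alg one_eq)
    then show False using \<open>\<alpha> \<notin> T\<close> fcls_eq_one_iff by blast
  qed
  then show ?thesis using T by (simp add: lin_theory_def)
qed

lemma ex_lin_theory_avoiding:
  assumes T: "lukasiewicz_theory T" and \<alpha>: "\<alpha> \<notin> T"
  shows "\<exists>P. lin_theory P \<and> T \<subseteq> P \<and> \<alpha> \<notin> P"
proof -
  define A where "A = {P. lukasiewicz_theory P \<and> T \<subseteq> P \<and> \<alpha> \<notin> P}"
  have "\<exists>P\<in>A. \<forall>X\<in>A. P \<subseteq> X \<longrightarrow> X = P"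
  proof (rule subset_Zorn_nonempty)
    show "A \<noteq> {}" using assms by (auto simp: A_def)
    fix \<C> assume ne: "\<C> \<noteq> {}" and ch: "subset.chain A \<C>"
    have "lukasiewicz_theory (\<Union>\<C>)"
    proof (rule lukasiewicz_theory_superset[OF T])
      show "T \<subseteq> \<Union>\<C>" using ne ch unfolding subset.chain_def A_def by blast
      fix \<phi> \<psi> assume "\<phi> \<in> \<Union>\<C>" "\<phi> \<^bold>\<rightarrow> \<psi> \<in> \<Union>\<C>"
      then obtain P where P: "P \<in> \<C>" "\<phi> \<in> P" "\<phi> \<^bold>\<rightarrow> \<psi> \<in> P"
        using ch unfolding subset_chain_def by blast
      then have "lukasiewicz_theory P" using ch unfolding subset_chain_def A_def by blast
      then show "\<psi> \<in> \<Union>\<C>" using P lukasiewicz_theory.modus_ponens by blast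
    qed
    then show "\<Union>\<C> \<in> A" using ne ch unfolding subset_chain_def A_def by blast
  qed
  then obtain P where "P \<in> A" and max: "\<And>X. X \<in> A \<Longrightarrow> P \<subseteq> X \<Longrightarrow> X = P" by blast
  moreover have "lin_theory P"
    by (rule maximal_avoiding_lin[where \<alpha> = \<alpha>]) (use \<open>P \<in> A\<close> max in \<open>auto simp: A_def\<close>)
  ultimately show ?thesis by (auto simp: A_def)
qed

section \<open>Valuations\<close>

text \<open>
  A map on formulas that respects \<open>\<oplus>\<close> and \<open>\<not>\<close>; boxed formulas are treated as atoms. Valuations that
  are 1 on the logic correspond to the worlds of the canonical model.
\<close>

definition valuation :: "('p mform \<Rightarrow> real) \<Rightarrow> bool" where
  "valuation v \<longleftrightarrow> (\<forall>\<phi>. v \<phi> \<in> {0..1}) \<and> (\<forall>\<phi>. v (\<^bold>\<not> \<phi>) = 1 - v \<phi>) \<and>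
     (\<forall>\<phi> \<psi>. v (\<phi> \<^bold>\<oplus> \<psi>) = min (v \<phi> + v \<psi>) 1)"

lemma valuationD:
  assumes "valuation v"
  shows "0 \<le> v \<phi>" "v \<phi> \<le> 1" "v (\<^bold>\<not> \<phi>) = 1 - v \<phi>" "v (\<phi> \<^bold>\<oplus> \<psi>) = min (v \<phi> + v \<psi>) 1"
    "v (\<phi> \<^bold>\<rightarrow> \<psi>) = min (1 - v \<phi> + v \<psi>) 1" "v (\<phi> \<^bold>\<odot> \<psi>) = max (v \<phi> + v \<psi> - 1) 0"
  using assms unfolding valuation_def fimp_def ftimes_def by (auto simp: min_def max_def)

lemma valuation_iff: "valuation v \<Longrightarrow> v (\<phi> \<^bold>\<leftrightarrow> \<psi>) = 1 \<Longrightarrow> v \<phi> = v \<psi>"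
  by (auto simp: fiff_def valuationD min_def max_def split: if_splits)

lemma ex_valuation_lin_theory:
  assumes "lin_theory P" "\<alpha> \<notin> P"
  shows "\<exists>v. valuation v \<and> (\<forall>\<phi>\<in>P. v \<phi> = 1) \<and> (\<forall>\<phi> \<psi>. \<phi> \<^bold>\<oplus> \<psi> \<notin> P \<longrightarrow> v \<phi> + v \<psi> \<le> 1)"
proof -
  interpret lukasiewicz_theory P using assms by (simp add: lin_theory_def)
  interpret mv_chain "free_alg P" "alg_plus P" "alg_neg P" "alg_zero P"
  proof
    show "le X Y \<or> le Y X" if "X \<in> free_alg P" "Y \<in> free_alg P" for X Y
      using that assms unfolding lin_theory_def by (metis free_algE le_fcls_iff)
    show "alg_zero P \<noteq> one"
    proof
      assume "alg_zero P = one"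
      then have "fcls P \<alpha> = one"
        using plus_zero[of "fcls P \<alpha>"] plus_one'(1)[of "fcls P \<alpha>"] fcls_in_free_alg by metis
      then show False using assms fcls_eq_one_iff one_eq by blast
    qed
  qed
  let ?v = "\<lambda>\<phi>. hom (fcls P \<phi>)"
  have "valuation ?v"
    unfolding valuation_def
    by (simp add: alg_neg_fcls[symmetric] alg_plus_fcls[symmetric] fcls_in_free_alg hom_nonneg hom_le_one
        hom_neg hom_plus)
  moreover have "?v \<phi> = 1" if "\<phi> \<in> P" for \<phi>
    using that hom_one by (simp add: fcls_theorem one_eq)
  moreover have "?v \<phi> + ?v \<psi> \<le> 1" if "\<phi> \<^bold>\<oplus> \<psi> \<notin> P" for \<phi> \<psi>
    using that fcls_eq_one_iff
    by (intro hom_plus_neq_one) (simp_all add: fcls_in_free_alg alg_plus_fcls one_eq)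
  ultimately show ?thesis by blast
qed

text \<open>
  The conclusion cannot be strengthened to \<open>v (\<phi> \<oplus> \<psi>) < 1\<close>: the formula \<open>\<phi> \<oplus> \<psi>\<close> may differ from 1 by an
  infinitesimal.
\<close>

lemma ex_valuation_avoiding:
  assumes "lukasiewicz_theory T" "\<phi> \<^bold>\<oplus> \<psi> \<notin> T"
  shows "\<exists>v. valuation v \<and> (\<forall>\<chi>\<in>T. v \<chi> = 1) \<and> v \<phi> + v \<psi> \<le> 1"
  using ex_lin_theory_avoiding[OF assms] ex_valuation_lin_theory by (metis subsetD)

lemma fpow_Suc: "m \<ge> 1 \<Longrightarrow> fpow \<phi> (Suc m) = \<phi> \<^bold>\<odot> fpow \<phi> m"
  by (cases m) (simp_all add: fpow_def)

lemma valuation_fpow: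
  assumes v: "valuation v" and "m \<ge> 1"
  shows "v (fpow \<phi> m) = max (1 - real m * (1 - v \<phi>)) 0"
  using \<open>m \<ge> 1\<close>
proof (induction m rule: dec_induct)
  case base
  show ?case using valuationD(1)[OF v, of \<phi>] by (simp add: fpow_def)
next
  case (step m)
  then show ?case using valuationD(1,2)[OF v, of \<phi>]
    by (simp add: fpow_Suc valuationD(6)[OF v] max_def algebra_simps)
qed

lemma fsubst_abbrev:
  "fsubst \<sigma> (\<phi> \<^bold>\<rightarrow> \<psi>) = fsubst \<sigma> \<phi> \<^bold>\<rightarrow> fsubst \<sigma> \<psi>"
  "fsubst \<sigma> (\<phi> \<^bold>\<odot> \<psi>) = fsubst \<sigma> \<phi> \<^bold>\<odot> fsubst \<sigma> \<psi>"
  "fsubst \<sigma> (\<phi> \<^bold>\<leftrightarrow> \<psi>) = (fsubst \<sigma> \<phi> \<^bold>\<leftrightarrow> fsubst \<sigma> \<psi>)"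
  by (simp_all add: fimp_def ftimes_def fiff_def)

lemma fsubst_fpow: "fsubst \<sigma> (fpow \<phi> m) = fpow (fsubst \<sigma> \<phi>) m"
proof -
  have "fsubst \<sigma> (((\<lambda>\<psi>. \<phi> \<^bold>\<odot> \<psi>) ^^ k) \<phi>) = ((\<lambda>\<psi>. fsubst \<sigma> \<phi> \<^bold>\<odot> \<psi>) ^^ k) (fsubst \<sigma> \<phi>)" for k
    by (induction k) (simp_all add: fsubst_abbrev)
  then show ?thesis by (simp add: fpow_def)
qed

section \<open>Separating reals by doubling and squaring\<close>

text \<open>
  Lists of booleans encode compositions of the two maps, applied from left to right; \<open>True\<close> stands
  for \<open>x \<odot> x\<close> and \<open>False\<close> for \<open>x \<oplus> x\<close>. One version acts on numbers and one on formulas.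
\<close>

definition rstep :: "bool \<Rightarrow> real \<Rightarrow> real"
  where "rstep b x = (if b then max (x + x - 1) 0 else min (x + x) 1)"

definition fstep :: "bool \<Rightarrow> 'p mform \<Rightarrow> 'p mform"
  where "fstep b \<phi> = (if b then \<phi> \<^bold>\<odot> \<phi> else \<phi> \<^bold>\<oplus> \<phi>)"

lemma fold_rstep_mono: "x \<le> y \<Longrightarrow> fold rstep bs x \<le> fold rstep bs y"
proof (induction bs arbitrary: x y)
  case (Cons b bs)
  from Cons.prems have "rstep b x \<le> rstep b y" by (auto simp: rstep_def)
  then show ?case using Cons.IH by simp
qed simp

text \<open>
  As long as \<open>x\<close> and \<open>y\<close> lie on the same side of \<open>1/2\<close>, one of the two maps doubles their distance;
  once they lie on different sides, \<open>x \<oplus> x < 1 = y \<oplus> y\<close>.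
\<close>

lemma separate_gap:
  "0 \<le> x \<Longrightarrow> x < y \<Longrightarrow> y \<le> 1 \<Longrightarrow> 1 \<le> 2 ^ n * (y - x) \<Longrightarrow>
    \<exists>bs. fold rstep bs x < 1 \<and> fold rstep bs y = 1"
proof (induction n arbitrary: x y)
  case 0
  then show ?case by (intro exI[of _ "[]"]) simp
next
  case (Suc n)
  consider "y \<le> 1/2" | "1/2 \<le> x" | "x < 1/2" "1/2 < y" by linarith
  then show ?case
  proof cases
    case 1
    then obtain bs where "fold rstep bs (2 * x) < 1" "fold rstep bs (2 * y) = 1"
      using Suc.IH[of "2 * x" "2 * y"] Suc.prems by (auto simp: algebra_simps)
    moreover have "rstep False x = 2 * x" "rstep False y = 2 * y"
      using 1 Suc.prems by (simp_all add: rstep_def)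
    ultimately show ?thesis by (intro exI[of _ "False # bs"]) simp
  next
    case 2
    then obtain bs where "fold rstep bs (2 * x - 1) < 1" "fold rstep bs (2 * y - 1) = 1"
      using Suc.IH[of "2 * x - 1" "2 * y - 1"] Suc.prems by (auto simp: algebra_simps)
    moreover have "rstep True x = 2 * x - 1" "rstep True y = 2 * y - 1"
      using 2 Suc.prems by (simp_all add: rstep_def)
    ultimately show ?thesis by (intro exI[of _ "True # bs"]) simp
  next
    case 3
    then show ?thesis by (intro exI[of _ "[False]"]) (simp add: rstep_def)
  qed
qed

lemma separate:
  assumes "0 \<le> x" "x < y" "y \<le> 1"
  shows "\<exists>bs. fold rstep bs x < 1 \<and> fold rstep bs y = 1"
proof -
  obtain n where "1 / (y - x) < 2 ^ n" using real_arch_pow[of 2] by fastforce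
  then have "1 \<le> 2 ^ n * (y - x)" using assms by (simp add: field_simps)
  then show ?thesis using separate_gap assms by blast
qed

lemma valuation_fold_fstep: "valuation v \<Longrightarrow> v (fold fstep bs \<phi>) = fold rstep bs (v \<phi>)"
proof (induction bs arbitrary: \<phi>)
  case (Cons b bs)
  have "v (fstep b \<phi>) = rstep b (v \<phi>)"
    using Cons.prems by (simp add: fstep_def rstep_def valuationD)
  then show ?case using Cons by simp
qed simp

section \<open>The canonical model\<close>

text \<open>
  Infinitely many variables ensure that there are three distinct ones, so that every instance of the
  axioms arises by substitution.
\<close>

locale modal_logic =
  fixes L :: "'p mform set"
  assumes logic: "modal_mv_logic L" and infinite_vars: "infinite (UNIV :: 'p set)"
begin

lemma L_modus_ponens: "\<phi> \<in> L \<Longrightarrow> \<phi> \<^bold>\<rightarrow> \<psi> \<in> L \<Longrightarrow> \<psi> \<in> L"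
  and L_subst: "\<phi> \<in> L \<Longrightarrow> fsubst \<sigma> \<phi> \<in> L"
  and L_nec: "\<phi> \<in> L \<Longrightarrow> \<^bold>\<box> \<phi> \<in> L"
  using logic unfolding modal_mv_logic_def by blast+

lemma L_instances:
  "\<phi> \<^bold>\<rightarrow> (\<psi> \<^bold>\<rightarrow> \<phi>) \<in> L"
  "(\<phi> \<^bold>\<rightarrow> \<psi>) \<^bold>\<rightarrow> ((\<psi> \<^bold>\<rightarrow> \<chi>) \<^bold>\<rightarrow> (\<phi> \<^bold>\<rightarrow> \<chi>)) \<in> L"
  "((\<phi> \<^bold>\<rightarrow> \<psi>) \<^bold>\<rightarrow> \<psi>) \<^bold>\<rightarrow> ((\<psi> \<^bold>\<rightarrow> \<phi>) \<^bold>\<rightarrow> \<phi>) \<in> L"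
  "(\<^bold>\<not> \<phi> \<^bold>\<rightarrow> \<^bold>\<not> \<psi>) \<^bold>\<rightarrow> (\<psi> \<^bold>\<rightarrow> \<phi>) \<in> L"
  "((\<phi> \<^bold>\<oplus> \<psi>) \<^bold>\<leftrightarrow> (\<^bold>\<not> \<psi> \<^bold>\<rightarrow> \<phi>)) \<in> L"
  "\<^bold>\<box> (\<phi> \<^bold>\<rightarrow> \<psi>) \<^bold>\<rightarrow> (\<^bold>\<box> \<phi> \<^bold>\<rightarrow> \<^bold>\<box> \<psi>) \<in> L"
  "(\<^bold>\<box> (\<phi> \<^bold>\<oplus> \<phi>) \<^bold>\<leftrightarrow> (\<^bold>\<box> \<phi> \<^bold>\<oplus> \<^bold>\<box> \<phi>)) \<in> L"
  "(\<^bold>\<box> (\<phi> \<^bold>\<odot> \<phi>) \<^bold>\<leftrightarrow> (\<^bold>\<box> \<phi> \<^bold>\<odot> \<^bold>\<box> \<phi>)) \<in> L"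
  "m \<ge> 1 \<Longrightarrow> (\<^bold>\<box> (\<phi> \<^bold>\<oplus> fpow \<phi> m) \<^bold>\<leftrightarrow> (\<^bold>\<box> \<phi> \<^bold>\<oplus> fpow (\<^bold>\<box> \<phi>) m)) \<in> L"
proof -
  obtain q p r :: 'p where "q \<noteq> p" "r \<noteq> p" "r \<noteq> q"
  proof -
    fix p :: 'p
    obtain q where "q \<notin> {p}" using ex_new_if_finite[OF infinite_vars, of "{p}"] by auto
    moreover obtain r where "r \<notin> {p, q}" using ex_new_if_finite[OF infinite_vars, of "{p, q}"] by auto
    ultimately show thesis using that by auto
  qed
  define \<sigma> where "\<sigma> = (\<lambda>x. if x = p then \<phi> else if x = q then \<psi> else \<chi>)"
  have \<sigma>: "\<sigma> p = \<phi>" "\<sigma> q = \<psi>" "\<sigma> r = \<chi>"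
    using \<open>q \<noteq> p\<close> \<open>r \<noteq> p\<close> \<open>r \<noteq> q\<close> by (auto simp: \<sigma>_def)
  note ax1 = logic[unfolded modal_mv_logic_def Let_def, THEN conjunct2, THEN conjunct2, THEN conjunct2,
      THEN spec[of _ p], THEN spec[of _ q], THEN spec[of _ r]]
  note ax2 = ax1[THEN conjunct2] note ax3 = ax2[THEN conjunct2] note ax4 = ax3[THEN conjunct2]
  note ax5 = ax4[THEN conjunct2] note ax6 = ax5[THEN conjunct2] note ax7 = ax6[THEN conjunct2]
  note ax8 = ax7[THEN conjunct2] note ax9 = ax8[THEN conjunct2, rule_format]
  note axs = ax1[THEN conjunct1] ax2[THEN conjunct1] ax3[THEN conjunct1] ax4[THEN conjunct1]
    ax5[THEN conjunct1] ax6[THEN conjunct1] ax7[THEN conjunct1] ax8[THEN conjunct1] ax9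
  note instances = axs[THEN L_subst[of _ \<sigma>], unfolded fsubst_abbrev fsubst_fpow fsubst.simps \<sigma>]
  show "\<phi> \<^bold>\<rightarrow> (\<psi> \<^bold>\<rightarrow> \<phi>) \<in> L"
    "(\<phi> \<^bold>\<rightarrow> \<psi>) \<^bold>\<rightarrow> ((\<psi> \<^bold>\<rightarrow> \<chi>) \<^bold>\<rightarrow> (\<phi> \<^bold>\<rightarrow> \<chi>)) \<in> L"
    "((\<phi> \<^bold>\<rightarrow> \<psi>) \<^bold>\<rightarrow> \<psi>) \<^bold>\<rightarrow> ((\<psi> \<^bold>\<rightarrow> \<phi>) \<^bold>\<rightarrow> \<phi>) \<in> L"
    "(\<^bold>\<not> \<phi> \<^bold>\<rightarrow> \<^bold>\<not> \<psi>) \<^bold>\<rightarrow> (\<psi> \<^bold>\<rightarrow> \<phi>) \<in> L"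
    "((\<phi> \<^bold>\<oplus> \<psi>) \<^bold>\<leftrightarrow> (\<^bold>\<not> \<psi> \<^bold>\<rightarrow> \<phi>)) \<in> L"
    "\<^bold>\<box> (\<phi> \<^bold>\<rightarrow> \<psi>) \<^bold>\<rightarrow> (\<^bold>\<box> \<phi> \<^bold>\<rightarrow> \<^bold>\<box> \<psi>) \<in> L"
    "(\<^bold>\<box> (\<phi> \<^bold>\<oplus> \<phi>) \<^bold>\<leftrightarrow> (\<^bold>\<box> \<phi> \<^bold>\<oplus> \<^bold>\<box> \<phi>)) \<in> L"
    "(\<^bold>\<box> (\<phi> \<^bold>\<odot> \<phi>) \<^bold>\<leftrightarrow> (\<^bold>\<box> \<phi> \<^bold>\<odot> \<^bold>\<box> \<phi>)) \<in> L"
    "m \<ge> 1 \<Longrightarrow> (\<^bold>\<box> (\<phi> \<^bold>\<oplus> fpow \<phi> m) \<^bold>\<leftrightarrow> (\<^bold>\<box> \<phi> \<^bold>\<oplus> fpow (\<^bold>\<box> \<phi>) m)) \<in> L"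
    by (fact instances)+
qed

sublocale lukasiewicz_theory L
  by unfold_locales (use L_modus_ponens L_instances in blast)+

text \<open>
  Worlds and valuations that are 1 on \<open>L\<close> determine each other.
\<close>

lemma mv_hom_valuation:
  assumes u: "u \<in> mv_homs L"
  shows "valuation (\<lambda>\<phi>. u (fcls L \<phi>))" "\<phi> \<in> L \<Longrightarrow> u (fcls L \<phi>) = 1"
proof -
  show "valuation (\<lambda>\<phi>. u (fcls L \<phi>))"
    using u unfolding valuation_def mv_homs_def
    by (auto simp: alg_neg_fcls[symmetric] alg_plus_fcls[symmetric] fcls_in_free_alg PiE_iff)
  show "u (fcls L \<phi>) = 1" if "\<phi> \<in> L"
    using u that by (simp add: mv_homs_def fcls_theorem alg_one_def)
qed

lemma valuation_mv_hom:
  assumes v: "valuation v" and L: "\<And>\<phi>. \<phi> \<in> L \<Longrightarrow> v \<phi> = 1"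
  shows "\<exists>w\<in>mv_homs L. \<forall>\<phi>. w (fcls L \<phi>) = v \<phi>"
proof -
  define w where "w = restrict (\<lambda>X. v (SOME \<phi>. \<phi> \<in> X)) (free_alg L)"
  have w: "w (fcls L \<phi>) = v \<phi>" for \<phi>
  proof -
    have "\<phi> \<in> fcls L \<phi>" by (simp add: mem_fcls_iff)
    then have "(SOME \<psi>. \<psi> \<in> fcls L \<phi>) \<in> fcls L \<phi>" by (rule someI)
    then have "(\<phi> \<^bold>\<leftrightarrow> (SOME \<psi>. \<psi> \<in> fcls L \<phi>)) \<in> L" by (simp add: fcls_def logeq_def)
    then have "v \<phi> = v (SOME \<psi>. \<psi> \<in> fcls L \<phi>)" using L valuation_iff[OF v] by blast
    then show ?thesis by (simp add: w_def fcls_in_free_alg)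
  qed
  obtain \<tau> where \<tau>: "\<tau> \<in> L" using imp_refl by blast
  have "w \<in> free_alg L \<rightarrow>\<^sub>E {0..1}"
    using valuationD(1,2)[OF v] by (auto simp: w_def)
  moreover have "w (alg_one L) = 1"
    using w[of \<tau>] L[OF \<tau>] by (simp add: alg_one_def fcls_theorem \<tau>)
  moreover have "w (alg_zero L) = 0"
    using L[OF \<tau>] by (simp add: alg_zero_fcls[OF \<tau>] w valuationD[OF v])
  ultimately have "w \<in> mv_homs L"
    unfolding mv_homs_def
    by (auto elim!: free_algE simp: alg_plus_fcls alg_times_fcls alg_neg_fcls w valuationD(3-6)[OF v])
  then show ?thesis using w by blast
qed

lemma alg_box_fcls: "alg_box L (fcls L \<phi>) = fcls L (\<^bold>\<box> \<phi>)"
proof -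
  have "\<^bold>\<box> \<alpha> \<^bold>\<rightarrow> \<^bold>\<box> \<beta> \<in> L" if "\<alpha> \<^bold>\<rightarrow> \<beta> \<in> L" for \<alpha> \<beta>
    using that L_nec L_instances(6) L_modus_ponens by blast
  then have "fcls L (\<^bold>\<box> \<phi>') = fcls L (\<^bold>\<box> \<phi>)" if "\<phi>' \<in> fcls L \<phi>" for \<phi>'
    using that unfolding mem_fcls_iff fcls_eq_iff by blast
  moreover have "\<phi> \<in> fcls L \<phi>" by (simp add: mem_fcls_iff)
  ultimately show ?thesis unfolding alg_box_def by blast
qed

lemma accs_canonical_iff:
  "(u, v) \<in> accs (canonical_model L) \<longleftrightarrow> u \<in> mv_homs L \<and> v \<in> mv_homs L \<and>
     (\<forall>\<phi>. u (fcls L (\<^bold>\<box> \<phi>)) = 1 \<longrightarrow> v (fcls L \<phi>) = 1)"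
proof -
  have "(\<forall>X \<in> free_alg L. u (alg_box L X) = 1 \<longrightarrow> v X = 1) \<longleftrightarrow>
      (\<forall>\<phi>. u (fcls L (\<^bold>\<box> \<phi>)) = 1 \<longrightarrow> v (fcls L \<phi>) = 1)"
    by (metis alg_box_fcls fcls_in_free_alg free_algE)
  then show ?thesis by (simp add: canonical_model_def)
qed

context
  fixes u assumes u: "u \<in> mv_homs L"
begin

lemma world_iff: "(\<phi> \<^bold>\<leftrightarrow> \<psi>) \<in> L \<Longrightarrow> u (fcls L \<phi>) = u (fcls L \<psi>)"
  using valuation_iff[OF mv_hom_valuation(1)[OF u]] mv_hom_valuation(2)[OF u] by blast

lemma world_box_fold_fstep: "u (fcls L (\<^bold>\<box> (fold fstep bs \<phi>))) = fold rstep bs (u (fcls L (\<^bold>\<box> \<phi>)))"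
proof (induction bs arbitrary: \<phi>)
  case (Cons b bs)
  have "u (fcls L (\<^bold>\<box> (fstep b \<phi>))) = u (fcls L (fstep b (\<^bold>\<box> \<phi>)))"
    by (rule world_iff) (simp add: fstep_def L_instances)
  also have "\<dots> = rstep b (u (fcls L (\<^bold>\<box> \<phi>)))"
    using valuationD[OF mv_hom_valuation(1)[OF u]] by (simp add: fstep_def rstep_def)
  finally show ?case using Cons by simp
qed simp

lemma box_le_successor:
  assumes acc: "(u, v) \<in> accs (canonical_model L)"
  shows "u (fcls L (\<^bold>\<box> \<phi>)) \<le> v (fcls L \<phi>)"
proof (rule ccontr)
  assume "\<not> ?thesis"
  moreover have v: "valuation (\<lambda>\<phi>. v (fcls L \<phi>))"
    using acc mv_hom_valuation accs_canonical_iff by blast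
  moreover note valuationD(1,2)[OF v] valuationD(1,2)[OF mv_hom_valuation(1)[OF u]]
  ultimately obtain bs where bs: "fold rstep bs (v (fcls L \<phi>)) < 1"
    "fold rstep bs (u (fcls L (\<^bold>\<box> \<phi>))) = 1"
    using separate[of "v (fcls L \<phi>)" "u (fcls L (\<^bold>\<box> \<phi>))"] by auto
  then have "v (fcls L (fold fstep bs \<phi>)) = 1"
    using acc world_box_fold_fstep accs_canonical_iff by metis
  then show False using bs(1) valuation_fold_fstep[OF v, of bs \<phi>] by simp
qed

text \<open>
  This is the place where the axioms on \<open>\<box>(p \<oplus> p\<^sup>m)\<close> are used.
\<close>

lemma ex_successor_lt_one:
  assumes lt: "u (fcls L (\<^bold>\<box> \<psi>)) < 1"
  shows "\<exists>v. (u, v) \<in> accs (canonical_model L) \<and> v (fcls L \<psi>) < 1"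
proof -
  note val = mv_hom_valuation(1)[OF u]
  define F where "F = {\<phi>. u (fcls L (\<^bold>\<box> \<phi>)) = 1}"
  have LF: "L \<subseteq> F" using L_nec mv_hom_valuation(2)[OF u] by (auto simp: F_def)
  have F: "lukasiewicz_theory F"
  proof (rule lukasiewicz_theory_superset[OF _ LF])
    show "lukasiewicz_theory L" by unfold_locales
    fix \<alpha> \<beta> assume "\<alpha> \<in> F" "\<alpha> \<^bold>\<rightarrow> \<beta> \<in> F"
    moreover have "u (fcls L (\<^bold>\<box> (\<alpha> \<^bold>\<rightarrow> \<beta>) \<^bold>\<rightarrow> (\<^bold>\<box> \<alpha> \<^bold>\<rightarrow> \<^bold>\<box> \<beta>))) = 1"
      by (rule mv_hom_valuation(2)[OF u L_instances(6)])
    ultimately show "\<beta> \<in> F" using valuationD(2)[OF val, of "\<^bold>\<box> \<beta>"]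
      by (simp add: F_def valuationD(5)[OF val])
  qed
  let ?a = "u (fcls L (\<^bold>\<box> \<psi>))"
  \<comment> \<open>\<open>m\<close> is chosen so large that \<open>(\<box>\<psi>)\<^sup>m\<close> has value 0 at \<open>u\<close>.\<close>
  obtain k where k: "1 < real k * (1 - ?a)" using lt ex_less_of_nat_mult[of "1 - ?a" 1] by auto
  define m where "m = Suc k"
  have m: "m \<ge> 1" "1 - real m * (1 - ?a) \<le> 0" using k lt by (auto simp: m_def algebra_simps)
  have "u (fcls L (\<^bold>\<box> (\<psi> \<^bold>\<oplus> fpow \<psi> m))) = u (fcls L (\<^bold>\<box> \<psi> \<^bold>\<oplus> fpow (\<^bold>\<box> \<psi>) m))"
    using m by (intro world_iff L_instances(9))
  also have "\<dots> = min ?a 1" using m valuation_fpow[OF val, of m "\<^bold>\<box> \<psi>"]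
    by (simp add: valuationD(4)[OF val] max_def)
  finally have "\<psi> \<^bold>\<oplus> fpow \<psi> m \<notin> F" using lt by (simp add: F_def)
  then obtain v where v: "valuation v" "\<And>\<phi>. \<phi> \<in> F \<Longrightarrow> v \<phi> = 1" "v \<psi> + v (fpow \<psi> m) \<le> 1"
    using ex_valuation_avoiding[OF F] by blast
  \<comment> \<open>If \<open>v \<psi> = 1\<close> then \<open>v (\<psi>\<^sup>m) = 1\<close> as well.\<close>
  have "v \<psi> \<noteq> 1" using v(3) valuation_fpow[OF v(1) m(1), of \<psi>] by auto
  then have "v \<psi> < 1" using valuationD(2)[OF v(1), of \<psi>] by simp
  obtain w where "w \<in> mv_homs L" "\<And>\<phi>. w (fcls L \<phi>) = v \<phi>"
    using valuation_mv_hom[OF v(1)] v(2) LF by blast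
  then show ?thesis using u v(2) \<open>v \<psi> < 1\<close>
    by (auto simp: accs_canonical_iff F_def intro!: exI[of _ w])
qed

lemma box_approximated:
  assumes "u (fcls L (\<^bold>\<box> \<phi>)) < r" "r \<le> 1"
  shows "\<exists>v. (u, v) \<in> accs (canonical_model L) \<and> v (fcls L \<phi>) < r"
proof -
  obtain bs where bs: "fold rstep bs (u (fcls L (\<^bold>\<box> \<phi>))) < 1" "fold rstep bs r = 1"
    using separate assms valuationD(1)[OF mv_hom_valuation(1)[OF u]] by blast
  then obtain v where acc: "(u, v) \<in> accs (canonical_model L)" and "v (fcls L (fold fstep bs \<phi>)) < 1"
    using ex_successor_lt_one world_box_fold_fstep by metis
  moreover have "valuation (\<lambda>\<phi>. v (fcls L \<phi>))"
    using acc mv_hom_valuation accs_canonical_iff by blast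
  ultimately have "fold rstep bs (v (fcls L \<phi>)) < fold rstep bs r"
    using bs(2) valuation_fold_fstep[of "\<lambda>\<phi>. v (fcls L \<phi>)" bs \<phi>] by simp
  then have "v (fcls L \<phi>) < r" using fold_rstep_mono[of r "v (fcls L \<phi>)" bs] by linarith
  then show ?thesis using acc by blast
qed

lemma box_eq_inf01:
  "u (fcls L (\<^bold>\<box> \<phi>)) = inf01 {v (fcls L \<phi>) | v. (u, v) \<in> accs (canonical_model L)}"
    (is "?a = inf01 ?S")
proof (cases "?a < 1")
  case True
  then have "?S \<noteq> {}" using box_approximated[of \<phi> 1] by auto
  moreover have "Inf ?S = ?a"
  proof (rule cInf_eq_non_empty)
    show "?a \<le> x" if "x \<in> ?S" for x using that box_le_successor by auto
    show "y \<le> ?a" if "\<And>x. x \<in> ?S \<Longrightarrow> y \<le> x" for y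
    proof (rule ccontr)
      assume "\<not> y \<le> ?a"
      then obtain v where "(u, v) \<in> accs (canonical_model L)" "v (fcls L \<phi>) < min y 1"
        using box_approximated[of \<phi> "min y 1"] True by auto
      then show False using that[of "v (fcls L \<phi>)"] by auto
    qed
  qed (use \<open>?S \<noteq> {}\<close> in auto)
  ultimately show ?thesis by (simp only: inf01_def if_False)
next
  case False
  then have a: "?a = 1" using valuationD(2)[OF mv_hom_valuation(1)[OF u], of "\<^bold>\<box> \<phi>"] by simp
  have "v (fcls L \<phi>) = 1" if "(u, v) \<in> accs (canonical_model L)" for v
    using that a accs_canonical_iff by blast
  then have "?S \<subseteq> {1}" by blast
  then have "?S = {} \<or> ?S = {1}" by (rule subset_singletonD)
  then have "inf01 ?S = 1"
    by (elim disjE) (simp_all only: inf01_def if_True if_False insert_not_empty cInf_singleton simp_thms)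
  then show ?thesis using a by (simp only:)
qed

end

lemma truth_lemma: "u \<in> mv_homs L \<Longrightarrow> fval (canonical_model L) \<phi> u = u (fcls L \<phi>)"
proof (induction \<phi> arbitrary: u)
  case (PVar p)
  then show ?case by (simp add: canonical_model_def)
next
  case (FNeg \<phi>)
  then show ?case using valuationD(3)[OF mv_hom_valuation(1)] by simp
next
  case (FPlus \<phi> \<psi>)
  then show ?case using valuationD(4)[OF mv_hom_valuation(1)] by simp
next
  case (FBox \<phi>)
  have "fval (canonical_model L) \<phi> v = v (fcls L \<phi>)" if "(u, v) \<in> accs (canonical_model L)" for v
    using that FBox.IH accs_canonical_iff by blast
  then have "{fval (canonical_model L) \<phi> v | v. (u, v) \<in> accs (canonical_model L)} =
      {v (fcls L \<phi>) | v. (u, v) \<in> accs (canonical_model L)}"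
    by metis
  then show ?case using box_eq_inf01[OF FBox.prems] by simp
qed

end

theorem proposition5p5:
  fixes L :: "'p mform set" and u :: "'p mform set \<Rightarrow> real" and \<phi> :: "'p mform"
  assumes "infinite (UNIV :: 'p set)"
    and "modal_mv_logic L"
    and "u \<in> worlds (canonical_model L)"
  shows "fval (canonical_model L) \<phi> u = u (fcls L \<phi>)"
proof -
  interpret modal_logic L using assms by unfold_locales
  show ?thesis using assms(3) by (intro truth_lemma) (simp add: canonical_model_def)
qed

end
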